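(* Every based ring $R$ has a canonical faithful grading by the group $U(R)$, namely the universal grading $R=\bigoplus_{a\in U(R)}R_a$. Any other faithful grading $R=\bigoplus_{g\in G}R^g$ of $R$ by a group $G$ is determined by a surjective group homomorphism $\pi:U(R)\to G$, i.e. $R^g=\bigoplus_{a\in U(R),\,\pi(a)=g}R_a$ for all $g\in G$.
   Context: A based ring is a pair $(R,B)$ where $R$ is a ring with identity, free of finite rank as a $\mathbb{Z}$-module, and $B=\{X_i\}_{i\in\mathcal{I}}$ is a $\mathbb{Z}$-basis of $R$ (its elements are called basic) such that $X_iX_j=\sum_{k}c_{ij}^kX_k$ with all $c_{ij}^k$ non-negative integers, the identity $1$ belongs to $B$ (all based rings are unital), and there is an involution $i\mapsto i^*$ of $\mathcal{I}$ whose induced map $X=\sum a_iX_i\mapsto X^*=\sum a_iX_{i^*}$ satisfies $(XY,Z)=(X,ZY^* )=(Y,X^*Z)$ for all $X,Y,Z\in R$, where $(\sum a_iX_i,\sum b_iX_i)=\sum a_ib_i$. A grading of $(R,B)$ by a finite group $G$ is a partition $B=\bigcup_{g\in G}B_g$ such that, with $R_g$ the $\mathbb{Z}$-span of $B_g$, one has $R=\bigoplus_g R_g$, $R_gR_h\subset R_{gh}$ and $R_g^*=R_{g^{-1}}$ for all $g,h\in G$. It is faithful if $R_g\ne0$ for all $g$. A based subring is a subring spanned by a subset of $B$ that is itself a based ring with that basis. $R_{ad}$ is the minimal based subring of $R$ containing $X_iX_i^*$ for all $i\in\mathcal{I}$. A based $R_{ad}$-subbimodule of $R$ is the $\mathbb{Z}$-span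 of a subset of $B$ stable under left and right multiplication by $R_{ad}$. $R$ decomposes uniquely as a direct sum $R=\bigoplus_{a\in A}R_a$ of indecomposable based $R_{ad}$-subbimodules, and the index set $A$ is a group with $ab=c$ if and only if $X_aX_b\in R_c$ for all $X_a\in R_a$, $X_b\in R_b$; its identity $1$ satisfies $R_1=R_{ad}$. This group is denoted $U(R)$ and called the universal grading group of $R$, and the decomposition $R=\bigoplus_{a\in U(R)}R_a$ is called the universal grading of $R$. *)

theory Defs
  imports "HOL-Algebra.Algebra" "HOL-Library.Disjoint_Sets"
begin

definition lincomb :: "('a, 'm) ring_scheme \<Rightarrow> 'a set \<Rightarrow> ('a \<Rightarrow> int) \<Rightarrow> 'a" where
  "lincomb R C c = (\<Oplus>\<^bsub>R\<^esub>x\<in>C. [c x] \<cdot>\<^bsub>R\<^esub> x)"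

definition Zspan :: "('a, 'm) ring_scheme \<Rightarrow> 'a set \<Rightarrow> 'a set" where
  "Zspan R C = range (lincomb R C)"

text \<open>Coordinate functions are taken extensional on the basis, so that each element of the ring
  has exactly one of them.\<close>

definition is_Zbasis :: "('a, 'm) ring_scheme \<Rightarrow> 'a set \<Rightarrow> bool" where
  "is_Zbasis R B \<longleftrightarrow> finite B \<and> B \<subseteq> carrier R
     \<and> bij_betw (lincomb R B) (B \<rightarrow>\<^sub>E UNIV) (carrier R)"

definition coord :: "('a, 'm) ring_scheme \<Rightarrow> 'a set \<Rightarrow> 'a \<Rightarrow> 'a \<Rightarrow> int" where
  "coord R B = the_inv_into (B \<rightarrow>\<^sub>E UNIV) (lincomb R B)"

definition based_form :: "('a, 'm) ring_scheme \<Rightarrow> 'a set \<Rightarrow> 'a \<Rightarrow> 'a \<Rightarrow> int" where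
  "based_form R B x y = (\<Sum>b\<in>B. coord R B x b * coord R B y b)"

text \<open>The basis is indexed by itself. Given \<open>d\<close> (the involution \<open>i \<mapsto> i\<^sup>*\<close> on basic elements),
  the following is the induced additive map \<open>X \<mapsto> X\<^sup>*\<close>.\<close>

definition induced_map :: "('a, 'm) ring_scheme \<Rightarrow> 'a set \<Rightarrow> ('a \<Rightarrow> 'a) \<Rightarrow> 'a \<Rightarrow> 'a" where
  "induced_map R B d x = (\<Oplus>\<^bsub>R\<^esub>b\<in>B. [coord R B x b] \<cdot>\<^bsub>R\<^esub> d b)"

definition is_based_involution :: "('a, 'm) ring_scheme \<Rightarrow> 'a set \<Rightarrow> ('a \<Rightarrow> 'a) \<Rightarrow> bool" where
  "is_based_involution R B d \<longleftrightarrow>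
     (\<forall>b\<in>B. d b \<in> B \<and> d (d b) = b)
     \<and> (\<forall>x\<in>carrier R. \<forall>y\<in>carrier R. \<forall>z\<in>carrier R.
          based_form R B (x \<otimes>\<^bsub>R\<^esub> y) z = based_form R B x (z \<otimes>\<^bsub>R\<^esub> induced_map R B d y)
        \<and> based_form R B (x \<otimes>\<^bsub>R\<^esub> y) z = based_form R B y (induced_map R B d x \<otimes>\<^bsub>R\<^esub> z))"

locale based_ring = ring R for R (structure) +
  fixes B
  assumes basis: "is_Zbasis R B"
    and structure_constants_nonneg:
      "\<And>x y z. \<lbrakk>x \<in> B; y \<in> B; z \<in> B\<rbrakk> \<Longrightarrow> coord R B (x \<otimes> y) z \<ge> 0"
    and one_basic: "\<one> \<in> B"
    and ex_involution: "\<exists>d. is_based_involution R B d"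

text \<open>The choice below is harmless: \<open>(XY, 1) = (X, Y\<^sup>*)\<close> determines \<open>Y\<^sup>*\<close>, so the involution
  of a based ring is unique on basic elements.\<close>

definition based_star :: "('a, 'm) ring_scheme \<Rightarrow> 'a set \<Rightarrow> 'a \<Rightarrow> 'a" where
  "based_star R B = induced_map R B (SOME d. is_based_involution R B d)"

text \<open>\<open>S\<close> is the internal direct sum of the finite family \<open>M i\<close>, \<open>i \<in> I\<close>, of additive
  subgroups of \<open>R\<close>: summation is a bijection from the product of the family onto \<open>S\<close>.\<close>

definition is_direct_sum ::
    "('a, 'm) ring_scheme \<Rightarrow> 'a set \<Rightarrow> 'i set \<Rightarrow> ('i \<Rightarrow> 'a set) \<Rightarrow> bool" where
  "is_direct_sum R S I M \<longleftrightarrow> finite I \<and> (\<forall>i\<in>I. additive_subgroup (M i) R)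
     \<and> bij_betw (\<lambda>f. \<Oplus>\<^bsub>R\<^esub>i\<in>I. f i) (\<Pi>\<^sub>E i\<in>I. M i) S"

definition is_grading :: "('a, 'm) ring_scheme \<Rightarrow> 'a set \<Rightarrow> ('g, 'n) monoid_scheme
    \<Rightarrow> ('g \<Rightarrow> 'a set) \<Rightarrow> bool" where
  "is_grading R B G M \<longleftrightarrow> group G \<and> finite (carrier G)
     \<and> (\<exists>P. disjoint_family_on P (carrier G) \<and> (\<Union>g\<in>carrier G. P g) = B
            \<and> (\<forall>g\<in>carrier G. M g = Zspan R (P g)))
     \<and> is_direct_sum R (carrier R) (carrier G) M
     \<and> (\<forall>g\<in>carrier G. \<forall>h\<in>carrier G. M g <#>\<^bsub>R\<^esub> M h \<subseteq> M (g \<otimes>\<^bsub>G\<^esub> h))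
     \<and> (\<forall>g\<in>carrier G. based_star R B ` M g = M (inv\<^bsub>G\<^esub> g))"

definition is_faithful_grading :: "('a, 'm) ring_scheme \<Rightarrow> 'a set \<Rightarrow> ('g, 'n) monoid_scheme
    \<Rightarrow> ('g \<Rightarrow> 'a set) \<Rightarrow> bool" where
  "is_faithful_grading R B G M \<longleftrightarrow>
     is_grading R B G M \<and> (\<forall>g\<in>carrier G. M g \<noteq> {\<zero>\<^bsub>R\<^esub>})"

definition is_based_subring :: "('a, 'm) ring_scheme \<Rightarrow> 'a set \<Rightarrow> 'a set \<Rightarrow> bool" where
  "is_based_subring R B S \<longleftrightarrow> subring S R
     \<and> (\<exists>C\<subseteq>B. S = Zspan R C \<and> based_ring (R\<lparr>carrier := S\<rparr>) C)"

definition adjoint_subring :: "('a, 'm) ring_scheme \<Rightarrow> 'a set \<Rightarrow> 'a set" where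
  "adjoint_subring R B = is_based_subring R B hull {x \<otimes>\<^bsub>R\<^esub> based_star R B x | x. x \<in> B}"

definition is_based_ad_subbimodule :: "('a, 'm) ring_scheme \<Rightarrow> 'a set \<Rightarrow> 'a set \<Rightarrow> bool" where
  "is_based_ad_subbimodule R B M \<longleftrightarrow> (\<exists>C\<subseteq>B. M = Zspan R C)
     \<and> adjoint_subring R B <#>\<^bsub>R\<^esub> M \<subseteq> M \<and> M <#>\<^bsub>R\<^esub> adjoint_subring R B \<subseteq> M"

definition is_indecomposable_ad_subbimodule ::
    "('a, 'm) ring_scheme \<Rightarrow> 'a set \<Rightarrow> 'a set \<Rightarrow> bool" where
  "is_indecomposable_ad_subbimodule R B M \<longleftrightarrow> is_based_ad_subbimodule R B M \<and> M \<noteq> {\<zero>\<^bsub>R\<^esub>}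
     \<and> \<not> (\<exists>N1 N2. is_based_ad_subbimodule R B N1 \<and> N1 \<noteq> {\<zero>\<^bsub>R\<^esub>}
               \<and> is_based_ad_subbimodule R B N2 \<and> N2 \<noteq> {\<zero>\<^bsub>R\<^esub>}
               \<and> N1 \<inter> N2 = {\<zero>\<^bsub>R\<^esub>} \<and> M = N1 <+>\<^bsub>R\<^esub> N2)"

definition is_ad_decomposition :: "('a, 'm) ring_scheme \<Rightarrow> 'a set \<Rightarrow> 'a set set \<Rightarrow> bool" where
  "is_ad_decomposition R B A \<longleftrightarrow> (\<forall>a\<in>A. is_indecomposable_ad_subbimodule R B a)
     \<and> is_direct_sum R (carrier R) A (\<lambda>a. a)"

text \<open>The set of components of the decomposition serves as its own index set, so that
  \<open>R\<^sub>a\<close> is \<open>a\<close> itself.\<close>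

definition ad_components :: "('a, 'm) ring_scheme \<Rightarrow> 'a set \<Rightarrow> 'a set set" where
  "ad_components R B = (THE A. is_ad_decomposition R B A)"

definition universal_grading_group :: "('a, 'm) ring_scheme \<Rightarrow> 'a set \<Rightarrow> 'a set monoid" where
  "universal_grading_group R B =
     \<lparr>carrier = ad_components R B,
      monoid.mult = (\<lambda>a b. THE c. c \<in> ad_components R B \<and> (\<forall>x\<in>a. \<forall>y\<in>b. x \<otimes>\<^bsub>R\<^esub> y \<in> c)),
      monoid.one = adjoint_subring R B\<rparr>"

definition universal_grading :: "('a, 'm) ring_scheme \<Rightarrow> 'a set \<Rightarrow> 'a set \<Rightarrow> 'a set" where
  "universal_grading R B a = a"

end

theory Submission
  imports Defs
begin

text \<open>Because structure constants are non-negative, nothing cancels in a product of basic elements: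
  which basic elements occur in \<open>xyz\<close> depends only on which ones occur in \<open>xy\<close> or in \<open>yz\<close>. So
  the product on \<open>B\<close> that assigns to \<open>x\<close> and \<open>y\<close> the set of basic elements occurring in \<open>xy\<close>
  is associative, and the identities \<open>(XY, Z) = (X, ZY\<^sup>*) = (Y, X\<^sup>*Z)\<close> say that membership \<open>z \<in> xy\<close> can be solved for
  \<open>x\<close> and for \<open>y\<close>. Such a structure is a polygroup, and the universal grading is a statement about
  polygroups.

  Let \<open>D\<close> be the sub-polygroup generated by all products \<open>xx\<^sup>*\<close>, and relate \<open>x\<close> to \<open>y\<close> if
  \<open>y \<in> tx\<close> for some \<open>t \<in> D\<close>. Two elements \<open>y, y'\<close> of one product \<open>xz\<close> are always related, since
  \<open>z \<in> x\<^sup>*y\<close> gives \<open>y' \<in> xx\<^sup>*y\<close>. The same observation, used for all the generators of \<open>D\<close>,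
  shows that multiplying by \<open>D\<close> from the right does not leave a class
  (\<open>adj_rel_right_mult_adjoint\<close>): the cosets of \<open>D\<close> are two-sided. Hence the relation is a congruence,
  the product is single-valued on classes, and the classes form a group.

  Back in the ring, sub-polygroups correspond to based subrings (\<open>is_based_subring_iff\<close>), so \<open>D\<close>
  spans \<open>R\<^sub>a\<^sub>d\<close>, and the indecomposable based \<open>R\<^sub>a\<^sub>d\<close>-subbimodules are the spans of single
  classes (\<open>indecomposable_iff\<close>). The group of classes is therefore \<open>U(R)\<close>, and it grades \<open>R\<close>.
  Given another faithful grading, its component of degree \<open>1\<close> is spanned by a sub-polygroup that
  contains every \<open>xx\<^sup>*\<close>, hence \<open>D\<close>. So the degree is constant on classes, and it is the required
  homomorphism.\<close>

section \<open>Polygroups and their adjoint congruence\<close>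

locale polygroup =
  fixes B :: "'a set" and hmult :: "'a \<Rightarrow> 'a \<Rightarrow> 'a set" (infixl "\<bullet>" 70)
    and e :: 'a and star :: "'a \<Rightarrow> 'a"
  assumes mem_hmultD: "z \<in> x \<bullet> y \<Longrightarrow> x \<in> B \<and> y \<in> B \<and> z \<in> B"
    and unit_in: "e \<in> B"
    and unit_left: "x \<in> B \<Longrightarrow> e \<bullet> x = {x}"
    and unit_right: "x \<in> B \<Longrightarrow> x \<bullet> e = {x}"
    and hmult_assoc: "(\<Union>p\<in>x \<bullet> y. p \<bullet> z) = (\<Union>q\<in>y \<bullet> z. x \<bullet> q)"
    and star_in: "x \<in> B \<Longrightarrow> star x \<in> B"
    and reverse_left: "z \<in> x \<bullet> y \<Longrightarrow> y \<in> star x \<bullet> z"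
    and reverse_right: "z \<in> x \<bullet> y \<Longrightarrow> x \<in> z \<bullet> star y"
begin

lemma assoc_right: "p \<in> x \<bullet> y \<Longrightarrow> w \<in> p \<bullet> z \<Longrightarrow> \<exists>q\<in>y \<bullet> z. w \<in> x \<bullet> q"
  using hmult_assoc[where x=x and y=y and z=z] by blast

lemma assoc_left: "q \<in> y \<bullet> z \<Longrightarrow> w \<in> x \<bullet> q \<Longrightarrow> \<exists>p\<in>x \<bullet> y. w \<in> p \<bullet> z"
  using hmult_assoc[where x=x and y=y and z=z] by blast

lemma unit_in_star_mult: "x \<in> B \<Longrightarrow> e \<in> star x \<bullet> x"
  using reverse_left[of x x e] unit_right by simp

lemma unit_in_mult_star: "x \<in> B \<Longrightarrow> e \<in> x \<bullet> star x"
  using reverse_right[of x e x] unit_left by simp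

lemma star_star: assumes "x \<in> B" shows "star (star x) = x"
proof -
  have "x \<in> star (star x) \<bullet> e"
    using reverse_left[OF unit_in_star_mult[OF assms]] .
  then show ?thesis using unit_right star_in assms by simp
qed

lemma star_antimult: assumes "z \<in> x \<bullet> y" shows "star z \<in> star y \<bullet> star x"
  by (rule reverse_left[OF reverse_right[OF reverse_left[OF assms]]])

lemma reverse_right': "x \<in> z \<bullet> star y \<Longrightarrow> y \<in> B \<Longrightarrow> z \<in> x \<bullet> y"
  using reverse_right[of x z "star y"] star_star by simp

text \<open>Since \<open>e \<in> y \<bullet> star y\<close>, the element \<open>x\<close> lies in \<open>x \<bullet> (y \<bullet> star y) = (x \<bullet> y) \<bullet> star y\<close>.\<close>

lemma hmult_nonempty: assumes "x \<in> B" "y \<in> B" shows "\<exists>z. z \<in> x \<bullet> y"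
proof -
  have "\<exists>p\<in>x \<bullet> y. x \<in> p \<bullet> star y"
    using assoc_left[OF unit_in_mult_star[OF assms(2)]] unit_right[OF assms(1)] by simp
  then show ?thesis by blast
qed

definition subpolygroup :: "'a set \<Rightarrow> bool" where
  "subpolygroup C \<longleftrightarrow> C \<subseteq> B \<and> e \<in> C \<and> (\<forall>x\<in>C. \<forall>y\<in>C. x \<bullet> y \<subseteq> C) \<and> (\<forall>x\<in>C. star x \<in> C)"

definition adjoint :: "'a set" where
  "adjoint = subpolygroup hull (\<Union>x\<in>B. x \<bullet> star x)"

lemma subpolygroup_whole: "subpolygroup B"
  unfolding subpolygroup_def by (blast dest: mem_hmultD intro: unit_in star_in)

lemma subpolygroup_hull: assumes "S \<subseteq> B" shows "subpolygroup (subpolygroup hull S)"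
proof -
  let ?H = "subpolygroup hull S"
  have "?H \<subseteq> B" using hull_minimal[of S B subpolygroup] assms subpolygroup_whole by blast
  moreover have "e \<in> ?H" "\<forall>x\<in>?H. star x \<in> ?H" by (simp_all add: hull_def subpolygroup_def)
  moreover have "\<forall>x\<in>?H. \<forall>y\<in>?H. x \<bullet> y \<subseteq> ?H" unfolding hull_def subpolygroup_def by blast
  ultimately show ?thesis unfolding subpolygroup_def[of ?H] by blast
qed

lemma subpolygroup_adjoint: "subpolygroup adjoint"
  unfolding adjoint_def by (rule subpolygroup_hull) (blast dest: mem_hmultD)

lemma adjoint_subset: "adjoint \<subseteq> B"
  and unit_in_adjoint: "e \<in> adjoint"
  and hmult_in_adjoint: "s \<in> adjoint \<Longrightarrow> t \<in> adjoint \<Longrightarrow> u \<in> s \<bullet> t \<Longrightarrow> u \<in> adjoint"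
  and star_in_adjoint: "t \<in> adjoint \<Longrightarrow> star t \<in> adjoint"
  using subpolygroup_adjoint unfolding subpolygroup_def by blast+

lemma mult_star_in_adjoint: "u \<in> x \<bullet> star x \<Longrightarrow> u \<in> adjoint"
  unfolding adjoint_def by (rule hull_inc) (use mem_hmultD in blast)

text \<open>The classes of this relation are the one-sided cosets \<open>adjoint \<bullet> x\<close>. Reversibility makes it
  symmetric.\<close>

definition adj_rel :: "('a \<times> 'a) set" where
  "adj_rel = {(x, y). \<exists>t\<in>adjoint. y \<in> t \<bullet> x}"

lemma adj_relI: "t \<in> adjoint \<Longrightarrow> y \<in> t \<bullet> x \<Longrightarrow> (x, y) \<in> adj_rel"
  unfolding adj_rel_def by blast

lemma adj_rel_refl: "x \<in> B \<Longrightarrow> (x, x) \<in> adj_rel"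
  using unit_left unit_in_adjoint by (auto intro: adj_relI)

lemma adj_rel_in: "(x, y) \<in> adj_rel \<Longrightarrow> x \<in> B \<and> y \<in> B"
  unfolding adj_rel_def using mem_hmultD by blast

lemma adj_rel_sym: assumes "(x, y) \<in> adj_rel" shows "(y, x) \<in> adj_rel"
proof -
  obtain t where "t \<in> adjoint" "y \<in> t \<bullet> x" using assms unfolding adj_rel_def by blast
  then show ?thesis by (rule adj_relI[OF star_in_adjoint reverse_left])
qed

lemma adj_rel_trans: assumes "(x, y) \<in> adj_rel" "(y, z) \<in> adj_rel" shows "(x, z) \<in> adj_rel"
proof -
  obtain s t where "s \<in> adjoint" "y \<in> s \<bullet> x" "t \<in> adjoint" "z \<in> t \<bullet> y"
    using assms unfolding adj_rel_def by blast
  then show ?thesis using assoc_left[of y s x z t] hmult_in_adjoint adj_relI by blast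
qed

lemma equiv_adj_rel: "equiv B adj_rel"
proof (rule equivI)
  show "adj_rel \<subseteq> B \<times> B" by (auto dest: adj_rel_in)
  show "refl_on B adj_rel" by (rule refl_onI) (rule adj_rel_refl)
  show "sym adj_rel" by (rule symI) (rule adj_rel_sym)
  show "trans adj_rel" by (rule transI) (rule adj_rel_trans)
qed

lemma adj_rel_unit_iff: "(e, x) \<in> adj_rel \<longleftrightarrow> x \<in> adjoint"
proof
  assume "(e, x) \<in> adj_rel"
  then obtain t where t: "t \<in> adjoint" "x \<in> t \<bullet> e" unfolding adj_rel_def by blast
  then show "x \<in> adjoint" using unit_right[of t] adjoint_subset by auto
next
  assume x: "x \<in> adjoint"
  then have "x \<in> x \<bullet> e" using unit_right adjoint_subset by auto
  with x show "(e, x) \<in> adj_rel" by (rule adj_relI)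
qed

text \<open>Reversing \<open>y \<in> x \<bullet> z\<close> gives \<open>z \<in> star x \<bullet> y\<close>, so that \<open>y' \<in> x \<bullet> z\<close> lies in
  \<open>(x \<bullet> star x) \<bullet> y\<close>. This is where the generators of the adjoint enter.\<close>

lemma adj_rel_common_product: assumes "y \<in> x \<bullet> z" "y' \<in> x \<bullet> z" shows "(y, y') \<in> adj_rel"
proof -
  have "\<exists>t\<in>x \<bullet> star x. y' \<in> t \<bullet> y"
    using assoc_left[OF reverse_left[OF assms(1)] assms(2)] .
  then show ?thesis using mult_star_in_adjoint adj_relI by blast
qed

text \<open>The elements \<open>u\<close> whose right multiplication preserves all classes form a sub-polygroup, so it
  is enough to treat the generators \<open>u \<in> z \<bullet> star z\<close>. Both \<open>y \<in> x \<bullet> u\<close> and \<open>x\<close> itself then lie in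
  \<open>(x \<bullet> z) \<bullet> star z\<close>, through elements \<open>s\<close> and \<open>s'\<close> of \<open>x \<bullet> z\<close>. These two are related, so \<open>s\<close> can
  be exchanged for \<open>s'\<close> at the cost of a left factor from the adjoint, and then \<open>x\<close> and the new
  element \<open>p\<close> lie in the common product \<open>s' \<bullet> star z\<close>.\<close>

lemma adj_rel_right_mult_adjoint:
  assumes "u \<in> adjoint" "y \<in> x \<bullet> u" shows "(x, y) \<in> adj_rel"
proof -
  define D where "D = {u \<in> B. \<forall>x y. y \<in> x \<bullet> u \<longrightarrow> (x, y) \<in> adj_rel}"
  have "subpolygroup D"
    unfolding subpolygroup_def
  proof (intro conjI ballI subsetI)
    fix u assume "u \<in> D" then show "u \<in> B" by (simp add: D_def)
  next
    have "(x, y) \<in> adj_rel" if "y \<in> x \<bullet> e" for x y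
      using that mem_hmultD[OF that] unit_right adj_rel_refl by auto
    then show "e \<in> D" by (simp add: D_def unit_in)
  next
    fix u v w assume uv: "u \<in> D" "v \<in> D" and w: "w \<in> u \<bullet> v"
    have "(x, y) \<in> adj_rel" if y: "y \<in> x \<bullet> w" for x y
    proof -
      obtain p where "p \<in> x \<bullet> u" "y \<in> p \<bullet> v" using assoc_left[OF w y] by blast
      then show ?thesis using uv adj_rel_trans unfolding D_def by blast
    qed
    then show "w \<in> D" using mem_hmultD[OF w] by (simp add: D_def)
  next
    fix u assume u: "u \<in> D"
    then have "(x, y) \<in> adj_rel" if "y \<in> x \<bullet> star u" for x y
      using reverse_right'[OF that] adj_rel_sym unfolding D_def by blast
    then show "star u \<in> D" using u star_in by (simp add: D_def)
  qed
  moreover have "(\<Union>z\<in>B. z \<bullet> star z) \<subseteq> D"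
  proof
    fix u assume "u \<in> (\<Union>z\<in>B. z \<bullet> star z)"
    then obtain z where z: "z \<in> B" and u: "u \<in> z \<bullet> star z" by blast
    have "(x, y) \<in> adj_rel" if y: "y \<in> x \<bullet> u" for x y
    proof -
      have x: "x \<in> B" using mem_hmultD[OF y] by simp
      obtain s where s: "s \<in> x \<bullet> z" "y \<in> s \<bullet> star z" using assoc_left[OF u y] by blast
      obtain s' where s': "s' \<in> x \<bullet> z" "x \<in> s' \<bullet> star z"
        using assoc_left[OF unit_in_mult_star[OF z]] unit_right[OF x] by blast
      obtain t where t: "t \<in> adjoint" "s \<in> t \<bullet> s'"
        using adj_rel_common_product[OF s'(1) s(1)] unfolding adj_rel_def by blast
      obtain p where p: "p \<in> s' \<bullet> star z" "y \<in> t \<bullet> p"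
        using assoc_right[OF t(2) s(2)] by blast
      show ?thesis
        using adj_rel_trans[OF adj_rel_common_product[OF s'(2) p(1)] adj_relI[OF t(1) p(2)]] .
    qed
    then show "u \<in> D" using mem_hmultD[OF u] by (simp add: D_def)
  qed
  ultimately have "adjoint \<subseteq> D" unfolding adjoint_def by (intro hull_minimal)
  then show ?thesis using assms unfolding D_def by blast
qed

lemma adj_rel_star: assumes "(x, y) \<in> adj_rel" shows "(star x, star y) \<in> adj_rel"
proof -
  obtain t where t: "t \<in> adjoint" "y \<in> t \<bullet> x" using assms unfolding adj_rel_def by blast
  then show ?thesis
    using adj_rel_right_mult_adjoint[OF star_in_adjoint] star_antimult by blast
qed

text \<open>Right cosets lie in left cosets by \<open>adj_rel_right_mult_adjoint\<close>; applying the involution to this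
  inclusion reverses it.\<close>

lemma adj_rel_right_witness:
  assumes "(x, y) \<in> adj_rel" shows "\<exists>t\<in>adjoint. y \<in> x \<bullet> t"
proof -
  have B: "x \<in> B" "y \<in> B" using adj_rel_in[OF assms] by auto
  obtain t where t: "t \<in> adjoint" "star y \<in> t \<bullet> star x"
    using adj_rel_star[OF assms] unfolding adj_rel_def by blast
  then have "y \<in> x \<bullet> star t" using star_antimult[OF t(2)] B star_star by simp
  then show ?thesis using t(1) star_in_adjoint by blast
qed

text \<open>Replacing \<open>x\<close> by a related element changes the product by a left factor from the adjoint, and
  replacing \<open>y\<close> by a right factor; neither leaves the class.\<close>

lemma adj_rel_mult:
  assumes "(x, x') \<in> adj_rel" "(y, y') \<in> adj_rel" "z \<in> x \<bullet> y" "z' \<in> x' \<bullet> y'"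
  shows "(z, z') \<in> adj_rel"
proof -
  obtain s where s: "s \<in> adjoint" "x' \<in> s \<bullet> x" using assms(1) unfolding adj_rel_def by blast
  obtain p where p: "p \<in> x \<bullet> y'" "z' \<in> s \<bullet> p" using assoc_right[OF s(2) assms(4)] by blast
  obtain t where t: "t \<in> adjoint" "y' \<in> y \<bullet> t" using adj_rel_right_witness[OF assms(2)] by blast
  obtain q where q: "q \<in> x \<bullet> y" "p \<in> q \<bullet> t" using assoc_left[OF t(2) p(1)] by blast
  have "(z, q) \<in> adj_rel" using adj_rel_common_product[OF assms(3) q(1)] .
  moreover have "(q, p) \<in> adj_rel" using adj_rel_right_mult_adjoint[OF t(1) q(2)] .
  moreover have "(p, z') \<in> adj_rel" using adj_relI[OF s(1) p(2)] .
  ultimately show ?thesis using adj_rel_trans by blast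
qed

end

section \<open>Coordinates\<close>

context based_ring
begin

lemma finite_basis: "finite B" and basis_subset: "B \<subseteq> carrier R"
  and lincomb_bij: "bij_betw (lincomb R B) (B \<rightarrow>\<^sub>E UNIV) (carrier R)"
  using basis by (auto simp: is_Zbasis_def)

lemma basis_carrier: "x \<in> B \<Longrightarrow> x \<in> carrier R"
  using basis_subset by blast

abbreviation co :: "'a \<Rightarrow> 'a \<Rightarrow> int" where "co \<equiv> coord R B"

lemma lincomb_closed: "C \<subseteq> carrier R \<Longrightarrow> lincomb R C c \<in> carrier R"
  unfolding lincomb_def by (intro finsum_closed) auto

lemma lincomb_cong: "C \<subseteq> carrier R \<Longrightarrow> (\<And>b. b \<in> C \<Longrightarrow> c b = c' b) \<Longrightarrow> lincomb R C c = lincomb R C c'"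
  unfolding lincomb_def by (intro finsum_cong') auto

text \<open>Expressing every span by coordinates with respect to the whole of \<open>B\<close> allows spans of different
  subsets to be compared.\<close>

lemma lincomb_extend:
  assumes "C \<subseteq> B" shows "lincomb R C c = lincomb R B (\<lambda>b. if b \<in> C then c b else 0)"
  unfolding lincomb_def
  by (rule add.finprod_mono_neutral_cong_left)
     (use assms finite_basis basis_carrier in \<open>auto simp: add_pow_int_ge\<close>)

lemma lincomb_coord: "x \<in> carrier R \<Longrightarrow> lincomb R B (co x) = x"
  unfolding coord_def using f_the_inv_into_f_bij_betw[OF lincomb_bij] by simp

lemma coord_lincomb: assumes "b \<in> B" shows "co (lincomb R B c) b = c b"
proof -
  have "lincomb R B c = lincomb R B (restrict c B)"
    by (rule lincomb_cong) (auto simp: basis_subset)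
  moreover have "co (lincomb R B (restrict c B)) = restrict c B"
    unfolding coord_def
    by (rule the_inv_into_f_f[OF bij_betw_imp_inj_on[OF lincomb_bij]]) auto
  ultimately show ?thesis using assms by simp
qed

lemma coord_eqI:
  assumes "x \<in> carrier R" "y \<in> carrier R" "\<And>b. b \<in> B \<Longrightarrow> co x b = co y b"
  shows "x = y"
  using lincomb_cong[of B "co x" "co y"] basis_subset assms by (simp add: lincomb_coord)

lemma coord_add:
  assumes "x \<in> carrier R" "y \<in> carrier R" "b \<in> B"
  shows "co (x \<oplus> y) b = co x b + co y b"
proof -
  have "lincomb R B (\<lambda>b. co x b + co y b) = (\<Oplus>b\<in>B. [co x b] \<cdot> b \<oplus> [co y b] \<cdot> b)"
    unfolding lincomb_def by (rule finsum_cong') (auto simp: basis_carrier add.int_pow_mult)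
  also have "\<dots> = lincomb R B (co x) \<oplus> lincomb R B (co y)"
    unfolding lincomb_def by (rule finsum_addf) (auto simp: basis_carrier)
  also have "\<dots> = x \<oplus> y" using assms by (simp add: lincomb_coord)
  finally show ?thesis using coord_lincomb[OF assms(3), of "\<lambda>b. co x b + co y b"] by simp
qed

lemma coord_zero: "b \<in> B \<Longrightarrow> co \<zero> b = 0"
  using coord_add[of \<zero> \<zero> b] by simp

lemma coord_minus: "x \<in> carrier R \<Longrightarrow> b \<in> B \<Longrightarrow> co (\<ominus> x) b = - co x b"
  using coord_add[of x "\<ominus> x" b] by (simp add: r_neg coord_zero)

lemma coord_finsum:
  assumes "finite I" "f \<in> I \<rightarrow> carrier R" "b \<in> B"
  shows "co (\<Oplus>i\<in>I. f i) b = (\<Sum>i\<in>I. co (f i) b)"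
  using assms(1,2)
  by (induction I rule: finite_induct) (auto simp: coord_zero coord_add assms(3) Pi_iff)

lemma coord_nat_multiple:
  fixes n :: nat
  shows "x \<in> carrier R \<Longrightarrow> b \<in> B \<Longrightarrow> co ([n] \<cdot> x) b = int n * co x b"
  by (induction n) (auto simp: coord_zero coord_add add.nat_pow_Suc algebra_simps)

lemma coord_int_multiple:
  fixes k :: int
  assumes "x \<in> carrier R" "b \<in> B" shows "co ([k] \<cdot> x) b = k * co x b"
  using assms
  by (cases "k \<ge> 0") (auto simp: add_pow_int_ge add_pow_int_lt coord_minus coord_nat_multiple)

lemma coord_basic: assumes "x \<in> B" "y \<in> B" shows "co x y = (if x = y then 1 else 0)"
proof -
  have "lincomb R B (\<lambda>b. if b = x then 1 else 0) = lincomb R {x} (\<lambda>_. 1)"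
    using lincomb_extend[of "{x}" "\<lambda>_. 1"] assms(1) by simp
  also have "\<dots> = x" using assms(1) by (simp add: lincomb_def basis_carrier)
  finally show ?thesis using coord_lincomb[OF assms(2), of "\<lambda>b. if b = x then 1 else 0"] by auto
qed

lemma coord_mult_left:
  assumes "x \<in> carrier R" "y \<in> carrier R" "z \<in> B"
  shows "co (x \<otimes> y) z = (\<Sum>a\<in>B. co x a * co (a \<otimes> y) z)"
proof -
  have "x \<otimes> y = (\<Oplus>a\<in>B. [co x a] \<cdot> a) \<otimes> y"
    using lincomb_coord[OF assms(1)] by (simp add: lincomb_def)
  also have "\<dots> = (\<Oplus>a\<in>B. ([co x a] \<cdot> a) \<otimes> y)"
    by (rule finsum_ldistr) (use assms finite_basis basis_carrier in auto)
  finally have "co (x \<otimes> y) z = (\<Sum>a\<in>B. co (([co x a] \<cdot> a) \<otimes> y) z)"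
    using coord_finsum[OF finite_basis _ assms(3)] assms basis_carrier by simp
  then show ?thesis
    using assms basis_carrier by (simp add: add_pow_ldistr_int coord_int_multiple)
qed

lemma coord_mult_right:
  assumes "x \<in> carrier R" "y \<in> carrier R" "z \<in> B"
  shows "co (x \<otimes> y) z = (\<Sum>a\<in>B. co y a * co (x \<otimes> a) z)"
proof -
  have "x \<otimes> y = x \<otimes> (\<Oplus>a\<in>B. [co y a] \<cdot> a)"
    using lincomb_coord[OF assms(2)] by (simp add: lincomb_def)
  also have "\<dots> = (\<Oplus>a\<in>B. x \<otimes> ([co y a] \<cdot> a))"
    by (rule finsum_rdistr) (use assms finite_basis basis_carrier in auto)
  finally have "co (x \<otimes> y) z = (\<Sum>a\<in>B. co (x \<otimes> ([co y a] \<cdot> a)) z)"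
    using coord_finsum[OF finite_basis _ assms(3)] assms basis_carrier by simp
  then show ?thesis
    using assms basis_carrier by (simp add: add_pow_rdistr_int coord_int_multiple)
qed

section \<open>Spans of sets of basic elements\<close>

text \<open>Spans of sets of basic elements are cut out by the vanishing of coordinates. This turns
  inclusions, intersections and sums of such spans into the same operations on subsets of \<open>B\<close>.\<close>

lemma Zspan_eq:
  assumes "C \<subseteq> B" shows "Zspan R C = {x \<in> carrier R. \<forall>b\<in>B - C. co x b = 0}"
proof (intro equalityI subsetI)
  fix x assume "x \<in> Zspan R C"
  then obtain c where "x = lincomb R C c" by (auto simp: Zspan_def)
  then show "x \<in> {x \<in> carrier R. \<forall>b\<in>B - C. co x b = 0}"
    using assms by (auto simp: lincomb_extend[OF assms] coord_lincomb lincomb_closed basis_subset)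
next
  fix x assume x: "x \<in> {x \<in> carrier R. \<forall>b\<in>B - C. co x b = 0}"
  have "lincomb R C (co x) = lincomb R B (co x)"
    unfolding lincomb_extend[OF assms] by (rule lincomb_cong) (use x basis_subset in auto)
  also have "\<dots> = x" using x by (simp add: lincomb_coord)
  finally show "x \<in> Zspan R C" unfolding Zspan_def by (metis rangeI)
qed

lemma Zspan_carrier: "C \<subseteq> B \<Longrightarrow> x \<in> Zspan R C \<Longrightarrow> x \<in> carrier R"
  by (simp add: Zspan_eq)

lemma Zspan_basis: "Zspan R B = carrier R"
  by (simp add: Zspan_eq)

lemma basic_in_Zspan_iff: "C \<subseteq> B \<Longrightarrow> x \<in> B \<Longrightarrow> x \<in> Zspan R C \<longleftrightarrow> x \<in> C"
  by (auto simp: Zspan_eq basis_carrier coord_basic)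

lemma Zspan_subset_iff: assumes "C \<subseteq> B" "D \<subseteq> B" shows "Zspan R C \<subseteq> Zspan R D \<longleftrightarrow> C \<subseteq> D"
proof
  assume "Zspan R C \<subseteq> Zspan R D"
  then show "C \<subseteq> D" using basic_in_Zspan_iff[OF assms(1)] basic_in_Zspan_iff[OF assms(2)] assms by blast
qed (use assms in \<open>auto simp: Zspan_eq\<close>)

lemma Zspan_inject: "C \<subseteq> B \<Longrightarrow> D \<subseteq> B \<Longrightarrow> Zspan R C = Zspan R D \<longleftrightarrow> C = D"
  using Zspan_subset_iff[of C D] Zspan_subset_iff[of D C] by auto

lemma Zspan_empty: "Zspan R {} = {\<zero>}"
  by (auto simp: Zspan_def lincomb_def)

lemma Zspan_eq_zero_iff: "C \<subseteq> B \<Longrightarrow> Zspan R C = {\<zero>} \<longleftrightarrow> C = {}"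
  using Zspan_inject[of C "{}"] by (simp add: Zspan_empty)

lemma Zspan_Int: "C \<subseteq> B \<Longrightarrow> D \<subseteq> B \<Longrightarrow> Zspan R C \<inter> Zspan R D = Zspan R (C \<inter> D)"
  by (subst Zspan_eq; auto simp: Zspan_eq)

lemma Zspan_additive_subgroup: assumes "C \<subseteq> B" shows "additive_subgroup (Zspan R C) R"
proof (rule additive_subgroupI, rule add.subgroupI)
  show "Zspan R C \<subseteq> carrier R" "Zspan R C \<noteq> {}"
    using assms by (auto simp: Zspan_eq intro!: exI[of _ \<zero>] coord_zero)
qed (use assms in \<open>auto simp: Zspan_eq coord_minus coord_add\<close>)

text \<open>Each basic element belongs to at most one \<open>P i\<close>, so each coordinate of a sum is the coordinate
  of a single summand.\<close>

lemma direct_sum_Zspan: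
  assumes I: "finite I" and P: "\<And>i. i \<in> I \<Longrightarrow> P i \<subseteq> B" and disj: "disjoint_family_on P I"
  shows "is_direct_sum R (Zspan R (\<Union>i\<in>I. P i)) I (\<lambda>i. Zspan R (P i))"
proof -
  let ?U = "\<Union>i\<in>I. P i" and ?s = "\<lambda>f. \<Oplus>i\<in>I. f i"
  have U: "?U \<subseteq> B" using P by auto
  have fR: "f \<in> I \<rightarrow> carrier R" if "f \<in> (\<Pi>\<^sub>E i\<in>I. Zspan R (P i))" for f
    using that P Zspan_carrier by (fastforce simp: PiE_iff)
  have off: "co (f i) b = 0" if "f \<in> (\<Pi>\<^sub>E i\<in>I. Zspan R (P i))" "i \<in> I" "b \<in> B" "b \<notin> P i" for f i b
    using that P by (force simp: PiE_iff Zspan_eq)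
  have co_sum: "co (?s f) b = co (f i) b"
    if f: "f \<in> (\<Pi>\<^sub>E i\<in>I. Zspan R (P i))" and i: "i \<in> I" and b: "b \<in> P i" for f i b
  proof -
    have bB: "b \<in> B" using P i b by auto
    have "co (f j) b = 0" if "j \<in> I - {i}" for j
      using off[OF f _ bB] that b i disj by (auto simp: disjoint_family_on_def)
    then show ?thesis
      using coord_finsum[OF I fR[OF f] bB] sum.remove[OF I i, of "\<lambda>j. co (f j) b"] by simp
  qed
  have "bij_betw ?s (\<Pi>\<^sub>E i\<in>I. Zspan R (P i)) (Zspan R ?U)"
    unfolding bij_betw_def
  proof (intro conjI inj_onI equalityI subsetI)
    fix f g assume f: "f \<in> (\<Pi>\<^sub>E i\<in>I. Zspan R (P i))" and g: "g \<in> (\<Pi>\<^sub>E i\<in>I. Zspan R (P i))"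
      and eq: "?s f = ?s g"
    show "f = g"
    proof (rule PiE_ext[OF f g])
      fix i assume i: "i \<in> I"
      show "f i = g i"
      proof (rule coord_eqI)
        show "f i \<in> carrier R" "g i \<in> carrier R" using fR[OF f] fR[OF g] i by auto
        show "co (f i) b = co (g i) b" if "b \<in> B" for b
          using co_sum[OF f i] co_sum[OF g i] off[OF f i that] off[OF g i that] eq
          by (cases "b \<in> P i") auto
      qed
    qed
  next
    fix x assume "x \<in> ?s ` (\<Pi>\<^sub>E i\<in>I. Zspan R (P i))"
    then obtain f where f: "f \<in> (\<Pi>\<^sub>E i\<in>I. Zspan R (P i))" and x: "x = ?s f" by blast
    have "co x b = 0" if "b \<in> B - ?U" for b
      using coord_finsum[OF I fR[OF f]] off[OF f] that x by simp
    then show "x \<in> Zspan R ?U" using U x fR[OF f] by (simp add: Zspan_eq)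
  next
    fix x assume x: "x \<in> Zspan R ?U"
    define f where "f = (\<lambda>i\<in>I. lincomb R (P i) (co x))"
    have f: "f \<in> (\<Pi>\<^sub>E i\<in>I. Zspan R (P i))" by (auto simp: f_def Zspan_def)
    have xR: "x \<in> carrier R" using Zspan_carrier[OF U x] .
    have "?s f = x"
    proof (rule coord_eqI)
      show "?s f \<in> carrier R" using fR[OF f] by simp
      show "co (?s f) b = co x b" if b: "b \<in> B" for b
      proof (cases "b \<in> ?U")
        case True
        then obtain i where i: "i \<in> I" "b \<in> P i" by blast
        have "co (f i) b = co x b"
          using i b by (simp add: f_def lincomb_extend[OF P] coord_lincomb)
        then show ?thesis using co_sum[OF f i] by simp
      next
        case False
        then have "co (?s f) b = 0" using coord_finsum[OF I fR[OF f] b] off[OF f] b by simp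
        then show ?thesis using x False b U by (simp add: Zspan_eq)
      qed
    qed (rule xR)
    then show "x \<in> ?s ` (\<Pi>\<^sub>E i\<in>I. Zspan R (P i))" using f by blast
  qed
  then show ?thesis
    using I P Zspan_additive_subgroup by (simp add: is_direct_sum_def)
qed

section \<open>The polygroup of basic elements\<close>

lemma based_form_basic_right:
  assumes "z \<in> B" shows "based_form R B x z = co x z"
proof -
  have "based_form R B x z = (\<Sum>b\<in>B. if b = z then co x b else 0)"
    unfolding based_form_def by (rule sum.cong) (auto simp: coord_basic assms)
  then show ?thesis using assms finite_basis by simp
qed

lemma based_form_basic_left: "x \<in> B \<Longrightarrow> based_form R B x z = co z x"
  using based_form_basic_right[of x z] by (simp add: based_form_def mult.commute)

lemma coord_induced_map:
  assumes d: "\<forall>b\<in>B. d b \<in> B \<and> d (d b) = b" and x: "x \<in> carrier R" and b: "b \<in> B"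
  shows "co (induced_map R B d x) b = co x (d b)"
proof -
  have "co (induced_map R B d x) b = (\<Sum>a\<in>B. co x a * co (d a) b)"
    unfolding induced_map_def
    using coord_finsum[OF finite_basis _ b, of "\<lambda>a. [co x a] \<cdot> d a"] d b
    by (simp add: coord_int_multiple basis_carrier)
  also have "\<dots> = (\<Sum>a\<in>B. if a = d b then co x a else 0)"
    by (rule sum.cong) (use d b in \<open>auto simp: coord_basic\<close>)
  finally show ?thesis using d b finite_basis by simp
qed

lemma induced_map_closed:
  "\<forall>b\<in>B. d b \<in> B \<and> d (d b) = b \<Longrightarrow> induced_map R B d x \<in> carrier R"
  unfolding induced_map_def by (intro finsum_closed) (auto simp: basis_carrier)

lemma induced_map_basic:
  assumes d: "\<forall>b\<in>B. d b \<in> B \<and> d (d b) = b" and x: "x \<in> B"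
  shows "induced_map R B d x = d x"
proof (rule coord_eqI)
  show "induced_map R B d x \<in> carrier R" "d x \<in> carrier R"
    using induced_map_closed[OF d] d x basis_carrier by auto
  show "co (induced_map R B d x) b = co (d x) b" if b: "b \<in> B" for b
    using coord_induced_map[OF d basis_carrier[OF x] b] d x b by (auto simp: coord_basic)
qed

text \<open>The form with a basic element reads off a coordinate, so the adjunction axioms of the involution
  become symmetries of the structure constants.\<close>

lemma frobenius_reciprocity:
  assumes d: "is_based_involution R B d" and B: "x \<in> B" "y \<in> B" "z \<in> B"
  shows "co (x \<otimes> y) z = co (z \<otimes> d y) x" and "co (x \<otimes> y) z = co (d x \<otimes> z) y"
proof -
  have dB: "\<forall>b\<in>B. d b \<in> B \<and> d (d b) = b" using d by (simp add: is_based_involution_def)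
  have "based_form R B (x \<otimes> y) z = based_form R B x (z \<otimes> induced_map R B d y)"
    and "based_form R B (x \<otimes> y) z = based_form R B y (induced_map R B d x \<otimes> z)"
    using d B[THEN basis_carrier] unfolding is_based_involution_def by blast+
  then show "co (x \<otimes> y) z = co (z \<otimes> d y) x" "co (x \<otimes> y) z = co (d x \<otimes> z) y"
    using B by (simp_all add: based_form_basic_left based_form_basic_right induced_map_basic[OF dB])
qed

definition star :: "'a \<Rightarrow> 'a" where "star = (SOME d. is_based_involution R B d)"

lemma star_involution: "is_based_involution R B star"
  unfolding star_def using ex_involution by (rule someI_ex)

lemma star_basic: "\<forall>b\<in>B. star b \<in> B \<and> star (star b) = b"
  using star_involution by (simp add: is_based_involution_def)

lemma based_star_eq: "based_star R B = induced_map R B star"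
  by (simp add: based_star_def star_def)

lemma based_star_basic: "x \<in> B \<Longrightarrow> based_star R B x = star x"
  by (simp add: based_star_eq induced_map_basic[OF star_basic])

text \<open>Membership of the factors in \<open>B\<close> is part of the condition, which makes the product empty
  elsewhere; associativity and reversibility then need no side conditions.\<close>

definition constituents :: "'a \<Rightarrow> 'a \<Rightarrow> 'a set" where
  "constituents x y = {z. x \<in> B \<and> y \<in> B \<and> z \<in> B \<and> co (x \<otimes> y) z \<noteq> 0}"

text \<open>All terms of the sum that computes a coordinate of a triple product are non-negative, so the
  coordinate is nonzero as soon as one term is.\<close>

lemma constituents_mult_left:
  assumes "x \<in> B" "y \<in> B" "z \<in> B" "w \<in> B"
  shows "co (x \<otimes> y \<otimes> z) w \<noteq> 0 \<longleftrightarrow> (\<exists>p\<in>constituents x y. w \<in> constituents p z)"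
proof -
  have "co (x \<otimes> y \<otimes> z) w = (\<Sum>p\<in>B. co (x \<otimes> y) p * co (p \<otimes> z) w)"
    using coord_mult_left[of "x \<otimes> y" z w] assms basis_carrier by simp
  also have "\<dots> \<noteq> 0 \<longleftrightarrow> (\<exists>p\<in>B. co (x \<otimes> y) p * co (p \<otimes> z) w \<noteq> 0)"
    using sum_nonneg_eq_0_iff[OF finite_basis, of "\<lambda>p. co (x \<otimes> y) p * co (p \<otimes> z) w"]
      structure_constants_nonneg assms by auto
  finally show ?thesis using assms by (auto simp: constituents_def)
qed

lemma constituents_mult_right:
  assumes "x \<in> B" "y \<in> B" "z \<in> B" "w \<in> B"
  shows "co (x \<otimes> (y \<otimes> z)) w \<noteq> 0 \<longleftrightarrow> (\<exists>q\<in>constituents y z. w \<in> constituents x q)"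
proof -
  have "co (x \<otimes> (y \<otimes> z)) w = (\<Sum>q\<in>B. co (y \<otimes> z) q * co (x \<otimes> q) w)"
    using coord_mult_right[of x "y \<otimes> z" w] assms basis_carrier by simp
  also have "\<dots> \<noteq> 0 \<longleftrightarrow> (\<exists>q\<in>B. co (y \<otimes> z) q * co (x \<otimes> q) w \<noteq> 0)"
    using sum_nonneg_eq_0_iff[OF finite_basis, of "\<lambda>q. co (y \<otimes> z) q * co (x \<otimes> q) w"]
      structure_constants_nonneg assms by auto
  finally show ?thesis using assms by (auto simp: constituents_def)
qed

text \<open>Associativity of \<open>R\<close> passes to constituents because both bracketings have the same nonzero
  coordinates, and Frobenius reciprocity gives reversibility.\<close>

sublocale pg: polygroup B constituents \<one> star
proof
  fix x y z
  show "z \<in> constituents x y \<Longrightarrow> x \<in> B \<and> y \<in> B \<and> z \<in> B" by (simp add: constituents_def)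
  show "\<one> \<in> B" by (rule one_basic)
  show "x \<in> B \<Longrightarrow> constituents \<one> x = {x}" "x \<in> B \<Longrightarrow> constituents x \<one> = {x}"
    using one_basic by (auto simp: constituents_def coord_basic basis_carrier)
  show "x \<in> B \<Longrightarrow> star x \<in> B" using star_basic by blast
  show "y \<in> constituents (star x) z" "x \<in> constituents z (star y)" if "z \<in> constituents x y"
    using that frobenius_reciprocity[OF star_involution, of x y z] star_basic
    by (simp_all add: constituents_def)
  show "(\<Union>p\<in>constituents x y. constituents p z) = (\<Union>q\<in>constituents y z. constituents x q)"
  proof (rule Set.set_eqI)
    fix w
    show "w \<in> (\<Union>p\<in>constituents x y. constituents p z)
        \<longleftrightarrow> w \<in> (\<Union>q\<in>constituents y z. constituents x q)"
    proof (cases "x \<in> B \<and> y \<in> B \<and> z \<in> B \<and> w \<in> B")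
      case True
      then show ?thesis
        using constituents_mult_left[of x y z w] constituents_mult_right[of x y z w]
        by (simp add: m_assoc basis_carrier)
    qed (auto simp: constituents_def)
  qed
qed

lemma mult_in_Zspan_iff:
  "x \<in> B \<Longrightarrow> y \<in> B \<Longrightarrow> C \<subseteq> B \<Longrightarrow> x \<otimes> y \<in> Zspan R C \<longleftrightarrow> constituents x y \<subseteq> C"
  by (auto simp: Zspan_eq constituents_def basis_carrier)

lemma Zspan_mult:
  assumes C: "C \<subseteq> B" and D: "D \<subseteq> B" and E: "E \<subseteq> B"
    and CDE: "\<And>a b. a \<in> C \<Longrightarrow> b \<in> D \<Longrightarrow> constituents a b \<subseteq> E"
    and x: "x \<in> Zspan R C" and y: "y \<in> Zspan R D"
  shows "x \<otimes> y \<in> Zspan R E"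
proof -
  have xy: "x \<in> carrier R" "y \<in> carrier R" using x y C D by (auto simp: Zspan_eq)
  have "co (x \<otimes> y) z = 0" if z: "z \<in> B - E" for z
  proof -
    have "co (x \<otimes> y) z = (\<Sum>a\<in>B. co x a * (\<Sum>b\<in>B. co y b * co (a \<otimes> b) z))"
      using coord_mult_left[OF xy, of z] coord_mult_right[OF _ xy(2), of _ z] z basis_carrier by simp
    also have "\<dots> = 0"
    proof (intro sum.neutral ballI)
      fix a assume a: "a \<in> B"
      have "co y b * co (a \<otimes> b) z = 0" if "a \<in> C" "b \<in> B" for b
        using that z y a CDE[of a b] D by (cases "b \<in> D") (auto simp: constituents_def Zspan_eq)
      then have "(\<Sum>b\<in>B. co y b * co (a \<otimes> b) z) = 0" if "a \<in> C"
        using that by (intro sum.neutral ballI)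
      then show "co x a * (\<Sum>b\<in>B. co y b * co (a \<otimes> b) z) = 0"
        using x a C by (cases "a \<in> C") (auto simp: Zspan_eq)
    qed
    finally show ?thesis .
  qed
  then show ?thesis using xy E by (simp add: Zspan_eq)
qed

text \<open>Multiplicative closure of spans, as it appears in subrings, bimodules and gradings, is closure of
  sets of basic elements under taking constituents.\<close>

lemma Zspan_set_mult_subset_iff:
  assumes "C \<subseteq> B" "D \<subseteq> B" "E \<subseteq> B"
  shows "Zspan R C <#> Zspan R D \<subseteq> Zspan R E \<longleftrightarrow> (\<forall>x\<in>C. \<forall>y\<in>D. constituents x y \<subseteq> E)"
proof
  assume L: "Zspan R C <#> Zspan R D \<subseteq> Zspan R E"
  show "\<forall>x\<in>C. \<forall>y\<in>D. constituents x y \<subseteq> E"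
  proof (intro ballI)
    fix x y assume xy: "x \<in> C" "y \<in> D"
    then have "x \<in> Zspan R C" "y \<in> Zspan R D" using assms basic_in_Zspan_iff by blast+
    then have "x \<otimes> y \<in> Zspan R C <#> Zspan R D" unfolding set_mult_def by blast
    then show "constituents x y \<subseteq> E" using L xy assms mult_in_Zspan_iff[of x y E] by blast
  qed
next
  assume "\<forall>x\<in>C. \<forall>y\<in>D. constituents x y \<subseteq> E"
  then show "Zspan R C <#> Zspan R D \<subseteq> Zspan R E"
    using Zspan_mult[OF assms] by (auto simp: set_mult_def)
qed

lemma Zspan_set_add:
  assumes "C \<subseteq> B" "D \<subseteq> B" shows "Zspan R C <+>\<^bsub>R\<^esub> Zspan R D = Zspan R (C \<union> D)"
proof (intro equalityI subsetI)
  fix x assume "x \<in> Zspan R C <+>\<^bsub>R\<^esub> Zspan R D"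
  then obtain y z where "x = y \<oplus> z" "y \<in> Zspan R C" "z \<in> Zspan R D" by (auto simp: set_add_def')
  then show "x \<in> Zspan R (C \<union> D)" using assms by (simp add: Zspan_eq coord_add)
next
  fix x assume x: "x \<in> Zspan R (C \<union> D)"
  let ?y = "lincomb R B (\<lambda>b. if b \<in> C then co x b else 0)"
    and ?z = "lincomb R B (\<lambda>b. if b \<in> C then 0 else co x b)"
  have yz: "?y \<in> carrier R" "?z \<in> carrier R" by (rule lincomb_closed[OF basis_subset])+
  have "x = ?y \<oplus> ?z"
    using x assms yz by (intro coord_eqI) (auto simp: coord_add coord_lincomb Zspan_eq)
  moreover have "?y \<in> Zspan R C" "?z \<in> Zspan R D"
    using x assms yz by (auto simp: Zspan_eq coord_lincomb)
  ultimately show "x \<in> Zspan R C <+>\<^bsub>R\<^esub> Zspan R D" unfolding set_add_def' by blast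
qed

lemma based_star_Zspan:
  assumes C: "C \<subseteq> B" shows "based_star R B ` Zspan R C = Zspan R (star ` C)"
proof -
  have sC: "star ` C \<subseteq> B" using C star_basic by auto
  have carr: "based_star R B x \<in> carrier R" for x
    using induced_map_closed[OF star_basic] by (simp add: based_star_eq)
  have co_star: "co (based_star R B x) b = co x (star b)" if "x \<in> carrier R" "b \<in> B" for x b
    using coord_induced_map[OF star_basic] that by (simp add: based_star_eq)
  have sub: "based_star R B x \<in> Zspan R (star ` D)" if D: "D \<subseteq> B" and x: "x \<in> Zspan R D" for x D
  proof -
    have sD: "star ` D \<subseteq> B" using D star_basic by auto
    have "star b \<notin> D" if "b \<in> B - star ` D" for b using that star_basic by (metis DiffD1 DiffD2 image_eqI)
    then show ?thesis using x D carr star_basic by (simp add: Zspan_eq[OF sD] Zspan_eq[OF D] co_star)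
  qed
  show ?thesis
  proof (intro equalityI subsetI)
    fix y assume "y \<in> based_star R B ` Zspan R C"
    then show "y \<in> Zspan R (star ` C)" using sub[OF C] by blast
  next
    fix y assume y: "y \<in> Zspan R (star ` C)"
    have yR: "y \<in> carrier R" using Zspan_carrier[OF sC y] .
    have "star ` star ` C = C" using C star_basic by (force simp: image_image)
    then have "based_star R B y \<in> Zspan R C" using sub[OF sC y] by simp
    moreover have "based_star R B (based_star R B y) = y"
      using star_basic by (intro coord_eqI) (simp_all add: co_star carr yR)
    ultimately show "y \<in> based_star R B ` Zspan R C" by (metis image_eqI)
  qed
qed

section \<open>Based subrings and the adjoint subring\<close>

text \<open>A based subring is \<open>R\<close> with a smaller carrier. Finite sums and integer multiples are defined
  through the carrier, so that they agree in both rings has to be proved; after that, coordinates,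
  form and involution of the smaller ring are restrictions of those of \<open>R\<close>.\<close>

lemma finsum_subgroup:
  assumes S: "additive_subgroup S R" and A: "finite A" and f: "f \<in> A \<rightarrow> S"
  shows "finsum (R\<lparr>carrier := S\<rparr>) f A = finsum R f A \<and> finsum R f A \<in> S"
proof -
  interpret S: additive_subgroup S R by (rule S)
  interpret S': comm_group "add_monoid (R\<lparr>carrier := S\<rparr>)"
  proof (rule group.group_comm_groupI)
    show "group (add_monoid (R\<lparr>carrier := S\<rparr>))"
      using subgroup.subgroup_is_group[OF S.a_subgroup add.is_group] by simp
  qed (use S.a_subset a_comm in auto)
  show ?thesis
    using A f
  proof (induction A rule: finite_induct)
    case empty
    have "finsum (R\<lparr>carrier := S\<rparr>) f {} = \<zero>"
      unfolding finsum_def using S'.finprod_empty[of f] by simp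
    then show ?case by simp
  next
    case (insert a A)
    have "finsum (R\<lparr>carrier := S\<rparr>) f (insert a A) = f a \<oplus> finsum (R\<lparr>carrier := S\<rparr>) f A"
      unfolding finsum_def using S'.finprod_insert[OF insert.hyps] insert.prems by (simp add: Pi_iff)
    moreover have "finsum R f (insert a A) = f a \<oplus> finsum R f A"
      using insert S.a_subset by (intro finsum_insert) auto
    ultimately show ?case using insert by (simp add: Pi_iff)
  qed
qed

lemma int_multiple_subgroup:
  fixes k :: int
  assumes "additive_subgroup S R" "x \<in> S"
  shows "[k] \<cdot>\<^bsub>R\<lparr>carrier := S\<rparr>\<^esub> x = [k] \<cdot> x" and "[k] \<cdot> x \<in> S"
proof -
  have S: "subgroup S (add_monoid R)" using additive_subgroup.a_subgroup[OF assms(1)] .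
  show "[k] \<cdot>\<^bsub>R\<lparr>carrier := S\<rparr>\<^esub> x = [k] \<cdot> x"
    using add.int_pow_consistent[OF S assms(2), of k] by (simp add: add_pow_def)
  show "[k] \<cdot> x \<in> S"
    using add.subgroup_int_pow_closed[OF S assms(2)] .
qed

lemma combination_subgroup:
  fixes c :: "'a \<Rightarrow> int"
  assumes S: "additive_subgroup S R" and A: "finite A" and f: "f \<in> A \<rightarrow> S"
  shows "(\<Oplus>\<^bsub>R\<lparr>carrier := S\<rparr>\<^esub>a\<in>A. [c a] \<cdot>\<^bsub>R\<lparr>carrier := S\<rparr>\<^esub> f a) = (\<Oplus>a\<in>A. [c a] \<cdot> f a)"
proof -
  have "(\<Oplus>\<^bsub>R\<lparr>carrier := S\<rparr>\<^esub>a\<in>A. [c a] \<cdot>\<^bsub>R\<lparr>carrier := S\<rparr>\<^esub> f a)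
      = (\<Oplus>a\<in>A. [c a] \<cdot>\<^bsub>R\<lparr>carrier := S\<rparr>\<^esub> f a)"
    using finsum_subgroup[OF S A, of "\<lambda>a. [c a] \<cdot>\<^bsub>R\<lparr>carrier := S\<rparr>\<^esub> f a"] f
      int_multiple_subgroup[OF S] by (simp add: Pi_iff)
  also have "\<dots> = (\<Oplus>a\<in>A. [c a] \<cdot> f a)"
    using f int_multiple_subgroup[OF S] additive_subgroup.a_subset[OF S]
    by (intro finsum_cong') (auto simp: Pi_iff)
  finally show ?thesis .
qed

lemma lincomb_Zspan_ring:
  assumes "C \<subseteq> B"
  shows "lincomb (R\<lparr>carrier := Zspan R C\<rparr>) C = lincomb R C"
proof
  fix c
  have "(\<lambda>x. x) \<in> C \<rightarrow> Zspan R C" using assms basic_in_Zspan_iff by blast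
  then show "lincomb (R\<lparr>carrier := Zspan R C\<rparr>) C c = lincomb R C c"
    unfolding lincomb_def
    using combination_subgroup[OF Zspan_additive_subgroup[OF assms], of C "\<lambda>x. x" c]
      finite_subset[OF assms finite_basis] by simp
qed

lemma is_Zbasis_Zspan_ring:
  assumes C: "C \<subseteq> B" shows "is_Zbasis (R\<lparr>carrier := Zspan R C\<rparr>) C"
  unfolding is_Zbasis_def lincomb_Zspan_ring[OF C]
proof (intro conjI)
  show "finite C" using finite_subset[OF C finite_basis] .
  show "C \<subseteq> carrier (R\<lparr>carrier := Zspan R C\<rparr>)" using C basic_in_Zspan_iff by auto
  have CR: "C \<subseteq> carrier R" using C basis_subset by auto
  have "bij_betw (lincomb R C) (C \<rightarrow>\<^sub>E UNIV) (Zspan R C)"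
    unfolding bij_betw_def
  proof (intro conjI inj_onI equalityI subsetI)
    fix c d :: "'a \<Rightarrow> int"
    assume cd: "c \<in> C \<rightarrow>\<^sub>E UNIV" "d \<in> C \<rightarrow>\<^sub>E UNIV" and eq: "lincomb R C c = lincomb R C d"
    show "c = d"
    proof (rule PiE_ext[OF cd])
      fix b assume b: "b \<in> C"
      have "co (lincomb R C c') b = c' b" for c'
        using b C coord_lincomb[of b] by (auto simp: lincomb_extend[OF C])
      then show "c b = d b" using eq by metis
    qed
  next
    fix x assume "x \<in> lincomb R C ` (C \<rightarrow>\<^sub>E UNIV)"
    then show "x \<in> Zspan R C" by (auto simp: Zspan_def)
  next
    fix x assume "x \<in> Zspan R C"
    then obtain c where "x = lincomb R C c" by (auto simp: Zspan_def)
    then have "x = lincomb R C (restrict c C)" using lincomb_cong[OF CR, of c "restrict c C"] by simp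
    moreover have "restrict c C \<in> C \<rightarrow>\<^sub>E UNIV" by simp
    ultimately show "x \<in> lincomb R C ` (C \<rightarrow>\<^sub>E UNIV)" by blast
  qed
  then show "bij_betw (lincomb R C) (C \<rightarrow>\<^sub>E UNIV) (carrier (R\<lparr>carrier := Zspan R C\<rparr>))" by simp
qed

lemma coord_Zspan_ring:
  assumes C: "C \<subseteq> B" and x: "x \<in> Zspan R C" and b: "b \<in> C"
  shows "coord (R\<lparr>carrier := Zspan R C\<rparr>) C x b = co x b"
proof -
  let ?c = "coord (R\<lparr>carrier := Zspan R C\<rparr>) C x"
  have "bij_betw (lincomb R C) (C \<rightarrow>\<^sub>E UNIV) (Zspan R C)"
    using is_Zbasis_Zspan_ring[OF C] by (simp add: is_Zbasis_def lincomb_Zspan_ring[OF C])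
  then have "lincomb R C ?c = x"
    unfolding coord_def lincomb_Zspan_ring[OF C] using x by (rule f_the_inv_into_f_bij_betw)
  then have "co x b = co (lincomb R C ?c) b" by simp
  also have "\<dots> = ?c b"
    using b C coord_lincomb[of b] by (auto simp: lincomb_extend[OF C])
  finally show ?thesis by simp
qed

lemma based_form_Zspan_ring:
  assumes C: "C \<subseteq> B" and x: "x \<in> Zspan R C" and y: "y \<in> Zspan R C"
  shows "based_form (R\<lparr>carrier := Zspan R C\<rparr>) C x y = based_form R B x y"
proof -
  have "based_form (R\<lparr>carrier := Zspan R C\<rparr>) C x y = (\<Sum>b\<in>C. co x b * co y b)"
    unfolding based_form_def by (rule sum.cong) (auto simp: coord_Zspan_ring[OF C] x y)
  also have "\<dots> = based_form R B x y"
    unfolding based_form_def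
    by (rule sum.mono_neutral_left) (use C x finite_basis in \<open>auto simp: Zspan_eq\<close>)
  finally show ?thesis .
qed

lemma induced_map_Zspan_ring:
  assumes C: "C \<subseteq> B" and sC: "star ` C \<subseteq> C" and x: "x \<in> Zspan R C"
  shows "induced_map (R\<lparr>carrier := Zspan R C\<rparr>) C star x = induced_map R B star x"
proof -
  let ?c = "coord (R\<lparr>carrier := Zspan R C\<rparr>) C x"
  have starC: "star \<in> C \<rightarrow> Zspan R C" using sC C basic_in_Zspan_iff by blast
  have off: "co x b = 0" if "b \<in> B" "b \<notin> C" for b using x that by (simp add: Zspan_eq[OF C])
  have "induced_map (R\<lparr>carrier := Zspan R C\<rparr>) C star x = (\<Oplus>b\<in>C. [?c b] \<cdot> star b)"
    unfolding induced_map_def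
    by (rule combination_subgroup[OF Zspan_additive_subgroup[OF C] finite_subset[OF C finite_basis] starC])
  also have "\<dots> = (\<Oplus>b\<in>B. [co x b] \<cdot> star b)"
    by (rule add.finprod_mono_neutral_cong_left)
       (use C x finite_basis star_basic basis_carrier in
         \<open>auto simp: coord_Zspan_ring[OF C x] off add_pow_int_ge\<close>)
  finally show ?thesis by (simp add: induced_map_def)
qed

lemma subring_Zspan:
  assumes C: "pg.subpolygroup C" shows "subring (Zspan R C) R"
proof -
  have CB: "C \<subseteq> B" and one: "\<one> \<in> C" and mult: "\<And>x y. x \<in> C \<Longrightarrow> y \<in> C \<Longrightarrow> constituents x y \<subseteq> C"
    using C by (auto simp: pg.subpolygroup_def)
  interpret S: additive_subgroup "Zspan R C" R by (rule Zspan_additive_subgroup[OF CB])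
  show ?thesis
  proof (rule subringI)
    show "Zspan R C \<subseteq> carrier R" by (rule S.a_subset)
    show "\<one> \<in> Zspan R C" using one one_basic CB basic_in_Zspan_iff by simp
    show "h1 \<otimes> h2 \<in> Zspan R C" if "h1 \<in> Zspan R C" "h2 \<in> Zspan R C" for h1 h2
      using Zspan_mult[OF CB CB CB mult that] .
  qed simp_all
qed

lemma is_based_subring_Zspan:
  assumes C: "pg.subpolygroup C" shows "is_based_subring R B (Zspan R C)"
proof -
  let ?S = "R\<lparr>carrier := Zspan R C\<rparr>"
  have CB: "C \<subseteq> B" and one: "\<one> \<in> C" and sC: "star ` C \<subseteq> C"
    using C by (auto simp: pg.subpolygroup_def)
  note sub = subring_Zspan[OF C]
  have basic: "x \<in> C \<Longrightarrow> x \<in> Zspan R C" for x using CB basic_in_Zspan_iff by blast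
  have star_closed: "induced_map R B star x \<in> Zspan R C" if x: "x \<in> Zspan R C" for x
  proof -
    have sCB: "star ` C \<subseteq> B" using sC CB by blast
    have "induced_map R B star x \<in> Zspan R (star ` C)"
      using based_star_Zspan[OF CB] x unfolding based_star_eq by blast
    then show ?thesis using Zspan_subset_iff[OF sCB CB] sC by blast
  qed
  have mult: "x \<otimes> y \<in> Zspan R C" if "x \<in> Zspan R C" "y \<in> Zspan R C" for x y
    using subringE(6)[OF sub that] .
  have invol: "is_based_involution ?S C star"
    unfolding is_based_involution_def
  proof (intro conjI ballI)
    fix x y z assume "x \<in> carrier ?S" "y \<in> carrier ?S" "z \<in> carrier ?S"
    then have xyz: "x \<in> Zspan R C" "y \<in> Zspan R C" "z \<in> Zspan R C" by auto
    then have R: "x \<in> carrier R" "y \<in> carrier R" "z \<in> carrier R" using Zspan_carrier[OF CB] by auto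
    have form: "based_form R B (x \<otimes> y) z = based_form R B x (z \<otimes> induced_map R B star y)"
        "based_form R B (x \<otimes> y) z = based_form R B y (induced_map R B star x \<otimes> z)"
      using star_involution R unfolding is_based_involution_def by blast+
    show "based_form ?S C (x \<otimes>\<^bsub>?S\<^esub> y) z = based_form ?S C x (z \<otimes>\<^bsub>?S\<^esub> induced_map ?S C star y)"
      and "based_form ?S C (x \<otimes>\<^bsub>?S\<^esub> y) z = based_form ?S C y (induced_map ?S C star x \<otimes>\<^bsub>?S\<^esub> z)"
      using form xyz
      by (simp_all add: based_form_Zspan_ring[OF CB] induced_map_Zspan_ring[OF CB sC]
          mult star_closed)
  qed (use sC CB star_basic in auto)
  have "based_ring ?S C"
  proof (intro based_ring.intro based_ring_axioms.intro)
    show "ring ?S" by (rule subring_is_ring[OF sub])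
    show "is_Zbasis ?S C" by (rule is_Zbasis_Zspan_ring[OF CB])
    show "0 \<le> coord ?S C (x \<otimes>\<^bsub>?S\<^esub> y) z" if "x \<in> C" "y \<in> C" "z \<in> C" for x y z
      using that structure_constants_nonneg[of x y z] CB
      by (simp add: coord_Zspan_ring[OF CB mult[OF basic basic]] subset_iff)
    show "\<one>\<^bsub>?S\<^esub> \<in> C" using one by simp
    show "\<exists>d. is_based_involution ?S C d" using invol by blast
  qed
  then show ?thesis using sub CB by (auto simp: is_based_subring_def)
qed

text \<open>From left to right one has to show that the set \<open>C\<close> of basic elements in the subring is closed
  under the involution of \<open>R\<close>, whereas the subring only comes with some involution of its own. The
  two agree, because \<open>\<one>\<close> occurs in \<open>xy\<close> only for \<open>y = star x\<close>.\<close>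

lemma is_based_subring_iff:
  "is_based_subring R B S \<longleftrightarrow> (\<exists>C. pg.subpolygroup C \<and> S = Zspan R C)"
proof
  assume "is_based_subring R B S"
  then obtain C where sub: "subring S R" and C: "C \<subseteq> B" and S: "S = Zspan R C"
    and br: "based_ring (R\<lparr>carrier := Zspan R C\<rparr>) C"
    by (auto simp: is_based_subring_def)
  interpret S: based_ring "R\<lparr>carrier := Zspan R C\<rparr>" C by (rule br)
  have mult: "constituents x y \<subseteq> C" if xy: "x \<in> C" "y \<in> C" for x y
  proof -
    have "x \<in> S" "y \<in> S" using xy C S basic_in_Zspan_iff by blast+
    then have "x \<otimes> y \<in> Zspan R C" using subringE(6)[OF sub] S by blast
    then show ?thesis using mult_in_Zspan_iff[of x y C] xy C by blast
  qed
  have star_closed: "star x \<in> C" if x: "x \<in> C" for x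
  proof -
    have y: "S.star x \<in> C" using S.star_basic x by blast
    have "\<one> \<in> S.constituents x (S.star x)" using S.pg.unit_in_mult_star[OF x] by simp
    then have "\<one> \<in> C" "coord (R\<lparr>carrier := Zspan R C\<rparr>) C (x \<otimes> S.star x) \<one> \<noteq> 0"
      by (auto simp: S.constituents_def)
    moreover have "x \<otimes> S.star x \<in> Zspan R C"
      using mult[OF x y] mult_in_Zspan_iff[of x "S.star x" C] x y C by blast
    ultimately have "\<one> \<in> constituents x (S.star x)"
      using x y C by (auto simp: constituents_def coord_Zspan_ring[OF C])
    then have "S.star x \<in> constituents (star x) \<one>" by (rule pg.reverse_left)
    then show ?thesis using pg.unit_right[of "star x"] star_basic x y C by auto
  qed
  have "pg.subpolygroup C"
    unfolding pg.subpolygroup_def using C mult star_closed S.one_basic by auto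
  then show "\<exists>C. pg.subpolygroup C \<and> S = Zspan R C" using S by blast
qed (use is_based_subring_Zspan in blast)

text \<open>Both sides are least among corresponding objects containing corresponding generators.\<close>

lemma adjoint_subring_eq: "adjoint_subring R B = Zspan R pg.adjoint"
  unfolding adjoint_subring_def
proof (rule hull_unique)
  have star_eq: "{x \<otimes> based_star R B x |x. x \<in> B} = {x \<otimes> star x |x. x \<in> B}"
    by (auto simp: based_star_basic) (metis based_star_basic)
  have gen: "{x \<otimes> based_star R B x |x. x \<in> B} \<subseteq> Zspan R C
      \<longleftrightarrow> (\<Union>x\<in>B. constituents x (star x)) \<subseteq> C" if C: "C \<subseteq> B" for C
    unfolding star_eq using mult_in_Zspan_iff[OF _ _ C] star_basic by fastforce
  show "{x \<otimes> based_star R B x |x. x \<in> B} \<subseteq> Zspan R pg.adjoint"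
    unfolding gen[OF pg.adjoint_subset] using pg.mult_star_in_adjoint by blast
  show "is_based_subring R B (Zspan R pg.adjoint)"
    by (rule is_based_subring_Zspan[OF pg.subpolygroup_adjoint])
  fix S assume "{x \<otimes> based_star R B x |x. x \<in> B} \<subseteq> S" "is_based_subring R B S"
  then obtain C where C: "pg.subpolygroup C" "S = Zspan R C"
    and sub: "{x \<otimes> based_star R B x |x. x \<in> B} \<subseteq> Zspan R C"
    unfolding is_based_subring_iff by auto
  have CB: "C \<subseteq> B" using C by (simp add: pg.subpolygroup_def)
  have "pg.adjoint \<subseteq> C"
    unfolding pg.adjoint_def using sub C(1) unfolding gen[OF CB] by (rule hull_minimal)
  then show "Zspan R pg.adjoint \<subseteq> S"
    using Zspan_subset_iff[OF pg.adjoint_subset CB] C(2) by simp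
qed

end

section \<open>The universal grading\<close>

lemma is_direct_sum_cong:
  assumes "\<And>i. i \<in> I \<Longrightarrow> M i = N i"
  shows "is_direct_sum R S I M \<longleftrightarrow> is_direct_sum R S I N"
  unfolding is_direct_sum_def using PiE_cong[of I M N] assms by simp

context based_ring
begin

definition component :: "'a \<Rightarrow> 'a set" where "component x = Zspan R (pg.adj_rel `` {x})"

lemma class_subset: "pg.adj_rel `` {x} \<subseteq> B"
  using pg.adj_rel_in by blast

lemma component_eq_iff: "x \<in> B \<Longrightarrow> y \<in> B \<Longrightarrow> component x = component y \<longleftrightarrow> (x, y) \<in> pg.adj_rel"
  unfolding component_def Zspan_inject[OF class_subset class_subset]
  using eq_equiv_class_iff[OF pg.equiv_adj_rel] by simp

lemma component_Int_basis: "component x \<inter> B = pg.adj_rel `` {x}"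
  unfolding component_def using basic_in_Zspan_iff[OF class_subset] class_subset by blast

lemma component_eq_Zspan: "a \<in> component ` B \<Longrightarrow> Zspan R (a \<inter> B) = a"
  by (auto simp: component_Int_basis) (auto simp: component_def)

lemma component_one: "component \<one> = adjoint_subring R B"
proof -
  have "pg.adj_rel `` {\<one>} = pg.adjoint" using pg.adj_rel_unit_iff by auto
  then show ?thesis by (simp add: component_def adjoint_subring_eq)
qed

text \<open>Stability on the left says that \<open>C\<close> is a union of classes; stability on the right then follows
  because cosets of the adjoint are two-sided.\<close>

lemma is_based_ad_subbimodule_Zspan_iff:
  assumes C: "C \<subseteq> B"
  shows "is_based_ad_subbimodule R B (Zspan R C) \<longleftrightarrow> pg.adj_rel `` C \<subseteq> C"
proof -
  have "is_based_ad_subbimodule R B (Zspan R C) \<longleftrightarrow>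
      (\<forall>t\<in>pg.adjoint. \<forall>x\<in>C. constituents t x \<subseteq> C) \<and> (\<forall>x\<in>C. \<forall>t\<in>pg.adjoint. constituents x t \<subseteq> C)"
    unfolding is_based_ad_subbimodule_def adjoint_subring_eq
      Zspan_set_mult_subset_iff[OF pg.adjoint_subset C C]
      Zspan_set_mult_subset_iff[OF C pg.adjoint_subset C]
    using C by auto
  also have "\<dots> \<longleftrightarrow> pg.adj_rel `` C \<subseteq> C"
  proof
    assume "(\<forall>t\<in>pg.adjoint. \<forall>x\<in>C. constituents t x \<subseteq> C) \<and> (\<forall>x\<in>C. \<forall>t\<in>pg.adjoint. constituents x t \<subseteq> C)"
    then show "pg.adj_rel `` C \<subseteq> C" unfolding pg.adj_rel_def by blast
  next
    assume closed: "pg.adj_rel `` C \<subseteq> C"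
    have "constituents t x \<subseteq> C" if "t \<in> pg.adjoint" "x \<in> C" for t x
      using closed that pg.adj_relI[OF that(1)] by blast
    moreover have "constituents x t \<subseteq> C" if "t \<in> pg.adjoint" "x \<in> C" for t x
      using closed that pg.adj_rel_right_mult_adjoint[OF that(1)] by blast
    ultimately show "(\<forall>t\<in>pg.adjoint. \<forall>x\<in>C. constituents t x \<subseteq> C) \<and> (\<forall>x\<in>C. \<forall>t\<in>pg.adjoint. constituents x t \<subseteq> C)"
      by blast
  qed
  finally show ?thesis .
qed

lemma is_based_ad_subbimoduleE:
  assumes "is_based_ad_subbimodule R B M"
  obtains C where "C \<subseteq> B" "M = Zspan R C" "pg.adj_rel `` C \<subseteq> C"
proof -
  obtain C where C: "C \<subseteq> B" "M = Zspan R C"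
    using assms unfolding is_based_ad_subbimodule_def by auto
  then show ?thesis using that[OF C] assms is_based_ad_subbimodule_Zspan_iff[OF C(1)] by simp
qed

text \<open>By the previous lemmas, based subbimodules are the spans of unions of classes, and such a union
  splits unless it is a single class.\<close>

lemma indecomposable_iff: "is_indecomposable_ad_subbimodule R B M \<longleftrightarrow> M \<in> component ` B"
proof
  assume M: "is_indecomposable_ad_subbimodule R B M"
  then have "is_based_ad_subbimodule R B M" by (simp add: is_indecomposable_ad_subbimodule_def)
  then obtain C where C: "C \<subseteq> B" "M = Zspan R C" "pg.adj_rel `` C \<subseteq> C"
    by (rule is_based_ad_subbimoduleE)
  have "C \<noteq> {}" using M C Zspan_empty by (auto simp: is_indecomposable_ad_subbimodule_def)
  then obtain x where x: "x \<in> C" by blast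
  let ?K = "pg.adj_rel `` {x}"
  have K: "?K \<subseteq> C" "x \<in> ?K" "pg.adj_rel `` ?K \<subseteq> ?K"
    using C x pg.adj_rel_trans pg.adj_rel_refl by blast+
  have CK: "C - ?K \<subseteq> B" "pg.adj_rel `` (C - ?K) \<subseteq> C - ?K"
    using C pg.adj_rel_trans pg.adj_rel_sym by blast+
  have "C - ?K = {}"
  proof (rule ccontr)
    assume ne: "C - ?K \<noteq> {}"
    have "is_based_ad_subbimodule R B (Zspan R ?K)" "Zspan R ?K \<noteq> {\<zero>}"
      using K is_based_ad_subbimodule_Zspan_iff[OF class_subset] Zspan_eq_zero_iff[OF class_subset] by auto
    moreover have "is_based_ad_subbimodule R B (Zspan R (C - ?K))" "Zspan R (C - ?K) \<noteq> {\<zero>}"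
      using ne CK is_based_ad_subbimodule_Zspan_iff[OF CK(1)] Zspan_eq_zero_iff[OF CK(1)] by auto
    moreover have "Zspan R ?K \<inter> Zspan R (C - ?K) = {\<zero>}"
      unfolding Zspan_Int[OF class_subset CK(1)] by (simp add: Zspan_empty)
    moreover have "M = Zspan R ?K <+>\<^bsub>R\<^esub> Zspan R (C - ?K)"
      unfolding Zspan_set_add[OF class_subset CK(1)] using C(2) K(1) by (simp add: Un_absorb1)
    ultimately show False using M unfolding is_indecomposable_ad_subbimodule_def by blast
  qed
  then have "C = ?K" using K(1) by blast
  then show "M \<in> component ` B" using x C by (auto simp: component_def)
next
  assume "M \<in> component ` B"
  then obtain x where x: "x \<in> B" and M: "M = Zspan R (pg.adj_rel `` {x})" by (auto simp: component_def)
  let ?K = "pg.adj_rel `` {x}"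
  have K: "x \<in> ?K" "pg.adj_rel `` ?K \<subseteq> ?K"
    using x pg.adj_rel_trans pg.adj_rel_refl by blast+
  have "\<not> (is_based_ad_subbimodule R B N1 \<and> N1 \<noteq> {\<zero>} \<and> is_based_ad_subbimodule R B N2 \<and> N2 \<noteq> {\<zero>}
      \<and> N1 \<inter> N2 = {\<zero>} \<and> M = N1 <+>\<^bsub>R\<^esub> N2)" for N1 N2
  proof (intro notI, elim conjE)
    assume N1: "is_based_ad_subbimodule R B N1" "N1 \<noteq> {\<zero>}"
      and N2: "is_based_ad_subbimodule R B N2" "N2 \<noteq> {\<zero>}"
      and int: "N1 \<inter> N2 = {\<zero>}" and sum: "M = N1 <+>\<^bsub>R\<^esub> N2"
    obtain C where C: "C \<subseteq> B" "N1 = Zspan R C" "pg.adj_rel `` C \<subseteq> C"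
      using N1(1) by (rule is_based_ad_subbimoduleE)
    obtain D where D: "D \<subseteq> B" "N2 = Zspan R D" "pg.adj_rel `` D \<subseteq> D"
      using N2(1) by (rule is_based_ad_subbimoduleE)
    have CD: "C \<union> D \<subseteq> B" "C \<inter> D \<subseteq> B" using C(1) D(1) by auto
    have ne: "C \<noteq> {}" "D \<noteq> {}" using N1(2) N2(2) C(2) D(2) Zspan_empty by auto
    have disj: "C \<inter> D = {}"
      using int Zspan_Int[OF C(1) D(1)] Zspan_eq_zero_iff[OF CD(2)] C(2) D(2) by simp
    have un: "?K = C \<union> D"
      using sum M Zspan_set_add[OF C(1) D(1)] Zspan_inject[OF class_subset CD(1)] C(2) D(2) by simp
    obtain c d where cd: "c \<in> C" "d \<in> D" using ne by blast
    then have "(x, c) \<in> pg.adj_rel" "(x, d) \<in> pg.adj_rel" using un by blast+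
    then have "(c, d) \<in> pg.adj_rel" using pg.adj_rel_trans[OF pg.adj_rel_sym] by blast
    then show False using C(3) cd disj by blast
  qed
  moreover have "is_based_ad_subbimodule R B M" "M \<noteq> {\<zero>}"
    using K M is_based_ad_subbimodule_Zspan_iff[OF class_subset] Zspan_eq_zero_iff[OF class_subset] by auto
  ultimately show "is_indecomposable_ad_subbimodule R B M"
    unfolding is_indecomposable_ad_subbimodule_def by blast
qed

lemma disjoint_components:
  assumes A: "A \<subseteq> component ` B" shows "disjoint_family_on (\<lambda>a. a \<inter> B) A"
proof (unfold disjoint_family_on_def, intro ballI impI)
  fix a b assume ab: "a \<in> A" "b \<in> A" "a \<noteq> b"
  then obtain x y where xy: "x \<in> B" "y \<in> B" "a = component x" "b = component y" using A by blast
  have "(x, y) \<notin> pg.adj_rel" using ab xy component_eq_iff by blast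
  then show "(a \<inter> B) \<inter> (b \<inter> B) = {}"
    unfolding xy component_Int_basis using pg.adj_rel_trans[OF _ pg.adj_rel_sym] by blast
qed

lemma direct_sum_components:
  assumes A: "A \<subseteq> component ` B"
  shows "is_direct_sum R (Zspan R (\<Union>a\<in>A. a \<inter> B)) A (\<lambda>a. a)"
proof -
  have "finite A" using A finite_basis by (meson finite_imageI finite_subset)
  then have "is_direct_sum R (Zspan R (\<Union>a\<in>A. a \<inter> B)) A (\<lambda>a. Zspan R (a \<inter> B))"
    using direct_sum_Zspan[OF _ _ disjoint_components[OF A]] by blast
  moreover have "Zspan R (a \<inter> B) = a" if "a \<in> A" for a using that A component_eq_Zspan by blast
  ultimately show ?thesis
    using is_direct_sum_cong[of A "\<lambda>a. Zspan R (a \<inter> B)" "\<lambda>a. a"] by blast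
qed

lemma Union_components: "(\<Union>a\<in>component ` B. a \<inter> B) = B"
proof (intro equalityI subsetI)
  fix x assume x: "x \<in> B"
  then have "x \<in> component x \<inter> B" unfolding component_Int_basis using pg.adj_rel_refl by blast
  with x show "x \<in> (\<Union>a\<in>component ` B. a \<inter> B)" by blast
qed blast

text \<open>Uniqueness holds because the components have to be spans of classes: if a class were missing,
  the sum of the others would be too small.\<close>

lemma is_ad_decomposition_iff: "is_ad_decomposition R B A \<longleftrightarrow> A = component ` B"
proof
  assume A: "is_ad_decomposition R B A"
  then have sub: "A \<subseteq> component ` B" by (auto simp: is_ad_decomposition_def indecomposable_iff)
  have "(\<lambda>f. \<Oplus>i\<in>A. f i) ` (\<Pi>\<^sub>E i\<in>A. i) = carrier R"
    using A by (simp add: is_ad_decomposition_def is_direct_sum_def bij_betw_def)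
  moreover have "(\<lambda>f. \<Oplus>i\<in>A. f i) ` (\<Pi>\<^sub>E i\<in>A. i) = Zspan R (\<Union>a\<in>A. a \<inter> B)"
    using direct_sum_components[OF sub] by (simp add: is_direct_sum_def bij_betw_def)
  ultimately have "Zspan R (\<Union>a\<in>A. a \<inter> B) = Zspan R B" by (simp add: Zspan_basis)
  then have cover: "(\<Union>a\<in>A. a \<inter> B) = B" using Zspan_inject[of "\<Union>a\<in>A. a \<inter> B" B] by blast
  have "component b \<in> A" if b: "b \<in> B" for b
  proof -
    obtain a where a: "a \<in> A" "b \<in> a \<inter> B" using b cover by blast
    then obtain x where x: "x \<in> B" "a = component x" using sub by blast
    then have "(x, b) \<in> pg.adj_rel" using a component_Int_basis by blast
    then show ?thesis using a x b component_eq_iff by metis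
  qed
  then show "A = component ` B" using sub by blast
next
  assume "A = component ` B"
  then show "is_ad_decomposition R B A"
    using direct_sum_components[of A] Union_components
    by (simp add: is_ad_decomposition_def indecomposable_iff Zspan_basis)
qed

lemma ad_components_eq: "ad_components R B = component ` B"
  unfolding ad_components_def is_ad_decomposition_iff by simp

abbreviation U :: "'a set monoid" where "U \<equiv> universal_grading_group R B"

lemma carrier_U: "carrier U = component ` B"
  by (simp add: universal_grading_group_def ad_components_eq)

lemma one_U: "\<one>\<^bsub>U\<^esub> = component \<one>"
  by (simp add: universal_grading_group_def component_one)

lemma component_mult_subset:
  assumes z: "z \<in> constituents x y" and u: "u \<in> component x" and v: "v \<in> component y"
  shows "u \<otimes> v \<in> component z"
proof -
  have "constituents a b \<subseteq> pg.adj_rel `` {z}"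
    if "a \<in> pg.adj_rel `` {x}" "b \<in> pg.adj_rel `` {y}" for a b
    using that pg.adj_rel_mult[OF _ _ z] by blast
  then show ?thesis
    using Zspan_mult[OF class_subset class_subset class_subset _ u[unfolded component_def] v[unfolded component_def]]
    by (simp add: component_def)
qed

text \<open>The value of the definite description in the product of \<open>U(R)\<close>: a component that contains the
  product of \<open>x\<close> and \<open>y\<close> contains all its constituents, in particular \<open>z\<close>, and components are
  disjoint on \<open>B\<close>.\<close>

lemma mult_U:
  assumes z: "z \<in> constituents x y" shows "component x \<otimes>\<^bsub>U\<^esub> component y = component z"
proof -
  have B: "x \<in> B" "y \<in> B" "z \<in> B" using z by (auto simp: constituents_def)
  have "(THE c. c \<in> component ` B \<and> (\<forall>u\<in>component x. \<forall>v\<in>component y. u \<otimes> v \<in> c)) = component z"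
  proof (rule the_equality)
    show "component z \<in> component ` B \<and> (\<forall>u\<in>component x. \<forall>v\<in>component y. u \<otimes> v \<in> component z)"
      using B component_mult_subset[OF z] by blast
  next
    fix c assume c: "c \<in> component ` B \<and> (\<forall>u\<in>component x. \<forall>v\<in>component y. u \<otimes> v \<in> c)"
    then obtain w where w: "w \<in> B" "c = component w" by blast
    have "x \<in> component x" "y \<in> component y" using B pg.adj_rel_refl component_Int_basis by blast+
    then have "x \<otimes> y \<in> component w" using c w by blast
    then have "(w, z) \<in> pg.adj_rel"
      unfolding component_def mult_in_Zspan_iff[OF B(1,2) class_subset] using z by blast
    then show "c = component z" using w B component_eq_iff by blast
  qed
  then show ?thesis by (simp add: universal_grading_group_def ad_components_eq)
qed

lemma group_U: "group U"
proof (rule groupI)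
  show "\<one>\<^bsub>U\<^esub> \<in> carrier U" using one_basic by (simp add: carrier_U one_U)
next
  fix a b assume "a \<in> carrier U" "b \<in> carrier U"
  then obtain x y where xy: "x \<in> B" "y \<in> B" "a = component x" "b = component y" by (auto simp: carrier_U)
  obtain z where z: "z \<in> constituents x y" using pg.hmult_nonempty xy by blast
  then show "a \<otimes>\<^bsub>U\<^esub> b \<in> carrier U"
    using mult_U[OF z] pg.mem_hmultD[OF z] xy by (simp add: carrier_U)
next
  fix a b c assume "a \<in> carrier U" "b \<in> carrier U" "c \<in> carrier U"
  then obtain x y z where B: "x \<in> B" "y \<in> B" "z \<in> B"
    and abc: "a = component x" "b = component y" "c = component z" by (auto simp: carrier_U)
  obtain p where p: "p \<in> constituents x y" using pg.hmult_nonempty B by blast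
  obtain w where w: "w \<in> constituents p z" using pg.hmult_nonempty[of p z] pg.mem_hmultD[OF p] B by blast
  obtain q where q: "q \<in> constituents y z" "w \<in> constituents x q" using pg.assoc_right[OF p w] by blast
  show "a \<otimes>\<^bsub>U\<^esub> b \<otimes>\<^bsub>U\<^esub> c = a \<otimes>\<^bsub>U\<^esub> (b \<otimes>\<^bsub>U\<^esub> c)"
    unfolding abc mult_U[OF p] mult_U[OF w] mult_U[OF q(1)] mult_U[OF q(2)] ..
next
  fix a assume "a \<in> carrier U"
  then obtain x where x: "x \<in> B" "a = component x" by (auto simp: carrier_U)
  show "\<one>\<^bsub>U\<^esub> \<otimes>\<^bsub>U\<^esub> a = a"
    using mult_U[of x \<one> x] pg.unit_left x by (simp add: one_U)
  show "\<exists>b\<in>carrier U. b \<otimes>\<^bsub>U\<^esub> a = \<one>\<^bsub>U\<^esub>"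
    using mult_U[OF pg.unit_in_star_mult[OF x(1)]] pg.star_in[OF x(1)] x
    by (auto simp: carrier_U one_U)
qed

lemma inv_U: assumes x: "x \<in> B" shows "inv\<^bsub>U\<^esub> (component x) = component (star x)"
  using group.inv_equality[OF group_U, of "component (star x)" "component x"]
    mult_U[OF pg.unit_in_star_mult[OF x]] pg.star_in[OF x] x
  by (simp add: carrier_U one_U)

lemma based_star_component: assumes x: "x \<in> B" shows "based_star R B ` component x = component (star x)"
proof -
  have "star ` (pg.adj_rel `` {x}) = pg.adj_rel `` {star x}"
  proof (intro equalityI subsetI)
    fix y assume "y \<in> star ` (pg.adj_rel `` {x})"
    then show "y \<in> pg.adj_rel `` {star x}" using pg.adj_rel_star by blast
  next
    fix y assume "y \<in> pg.adj_rel `` {star x}"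
    then have y: "(star x, y) \<in> pg.adj_rel" by blast
    then have "(x, star y) \<in> pg.adj_rel" using pg.adj_rel_star[OF y] pg.star_star[OF x] by simp
    moreover have "y = star (star y)" using pg.star_star pg.adj_rel_in[OF y] by simp
    ultimately show "y \<in> star ` (pg.adj_rel `` {x})" by blast
  qed
  then show ?thesis unfolding component_def based_star_Zspan[OF class_subset] by simp
qed

lemma universal_grading_faithful: "is_faithful_grading R B U (universal_grading R B)"
proof -
  have ug: "universal_grading R B = (\<lambda>a. a)" by (simp add: fun_eq_iff universal_grading_def)
  have ds: "is_direct_sum R (carrier R) (carrier U) (\<lambda>a. a)"
    using direct_sum_components[of "component ` B"] Union_components by (simp add: carrier_U Zspan_basis)
  have "disjoint_family_on (\<lambda>a. a \<inter> B) (carrier U)"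
    using disjoint_components[of "carrier U"] by (simp add: carrier_U)
  moreover have "(\<Union>a\<in>carrier U. a \<inter> B) = B" using Union_components by (simp add: carrier_U)
  moreover have "\<forall>a\<in>carrier U. a = Zspan R (a \<inter> B)" using component_eq_Zspan by (simp add: carrier_U)
  moreover have "a <#> b \<subseteq> a \<otimes>\<^bsub>U\<^esub> b" if ab: "a \<in> carrier U" "b \<in> carrier U" for a b
  proof -
    obtain x y where xy: "x \<in> B" "y \<in> B" "a = component x" "b = component y" using ab by (auto simp: carrier_U)
    obtain z where z: "z \<in> constituents x y" using pg.hmult_nonempty xy by blast
    show ?thesis unfolding xy mult_U[OF z] using component_mult_subset[OF z] by (auto simp: set_mult_def)
  qed
  moreover have "based_star R B ` a = inv\<^bsub>U\<^esub> a" if "a \<in> carrier U" for a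
    using that by (elim imageE[where f = component and A = B, folded carrier_U])
      (simp only: inv_U based_star_component)
  moreover have "a \<noteq> {\<zero>}" if "a \<in> carrier U" for a
    using that indecomposable_iff[of a] by (simp add: carrier_U is_indecomposable_ad_subbimodule_def)
  moreover have "finite (carrier U)" using finite_basis by (simp add: carrier_U)
  ultimately show ?thesis
    unfolding is_faithful_grading_def is_grading_def ug
    using group_U ds by (auto intro!: exI[of _ "\<lambda>a. a \<inter> B"])
qed

section \<open>Universality\<close>

text \<open>The degree of a basic element is constant on classes, since the part of degree \<open>\<one>\<close> contains
  the adjoint. The homomorphism sends a class to the degree of its members.\<close>

lemma faithful_grading_factors:
  fixes G :: "('g, 'n) monoid_scheme"
  assumes "is_faithful_grading R B G M"
  shows "\<exists>\<pi>\<in>epi U G. \<forall>g\<in>carrier G.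
    is_direct_sum R (M g) {a \<in> carrier U. \<pi> a = g} (universal_grading R B)"
proof -
  have grG: "group G"
    and mult: "\<And>g h. g \<in> carrier G \<Longrightarrow> h \<in> carrier G \<Longrightarrow> M g <#> M h \<subseteq> M (g \<otimes>\<^bsub>G\<^esub> h)"
    and starM: "\<And>g. g \<in> carrier G \<Longrightarrow> based_star R B ` M g = M (inv\<^bsub>G\<^esub> g)"
    and nz: "\<And>g. g \<in> carrier G \<Longrightarrow> M g \<noteq> {\<zero>}"
    using assms by (auto simp: is_faithful_grading_def is_grading_def)
  obtain P where disj: "disjoint_family_on P (carrier G)" and cover: "(\<Union>g\<in>carrier G. P g) = B"
    and M: "\<And>g. g \<in> carrier G \<Longrightarrow> M g = Zspan R (P g)"
    using assms unfolding is_faithful_grading_def is_grading_def by blast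
  interpret G: group G by (rule grG)
  have PB: "P g \<subseteq> B" if "g \<in> carrier G" for g using cover that by blast
  have uniq: "g = h" if "x \<in> P g" "x \<in> P h" "g \<in> carrier G" "h \<in> carrier G" for x g h
    using disj that unfolding disjoint_family_on_def by blast
  have Pmult: "z \<in> P (g \<otimes>\<^bsub>G\<^esub> h)"
    if "g \<in> carrier G" "h \<in> carrier G" "x \<in> P g" "y \<in> P h" "z \<in> constituents x y" for g h x y z
  proof -
    have "\<forall>x\<in>P g. \<forall>y\<in>P h. constituents x y \<subseteq> P (g \<otimes>\<^bsub>G\<^esub> h)"
      using mult[of g h] that Zspan_set_mult_subset_iff[of "P g" "P h" "P (g \<otimes>\<^bsub>G\<^esub> h)"] PB M by simp
    then show ?thesis using that by blast
  qed
  have Pstar: "star x \<in> P (inv\<^bsub>G\<^esub> g)" if g: "g \<in> carrier G" and x: "x \<in> P g" for g x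
  proof -
    have "Zspan R (star ` P g) = Zspan R (P (inv\<^bsub>G\<^esub> g))"
      using starM[OF g] M g based_star_Zspan[OF PB[OF g]] by simp
    moreover have "star ` P g \<subseteq> B" using PB[OF g] star_basic by blast
    ultimately have "star ` P g = P (inv\<^bsub>G\<^esub> g)"
      using Zspan_inject[OF _ PB[of "inv\<^bsub>G\<^esub> g"]] g by simp
    then show ?thesis using x by blast
  qed
  have Pone: "\<one> \<in> P \<one>\<^bsub>G\<^esub>"
  proof -
    obtain g where g: "g \<in> carrier G" "\<one> \<in> P g" using cover one_basic by blast
    have "\<one> \<in> P (g \<otimes>\<^bsub>G\<^esub> g)" using Pmult[OF g(1) g(1) g(2) g(2)] pg.unit_left[OF one_basic] by simp
    \<comment> \<open>the degree of \<open>\<one>\<close> is idempotent\<close>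
    then have "g = g \<otimes>\<^bsub>G\<^esub> g" using uniq g by blast
    then have "g = \<one>\<^bsub>G\<^esub>" using g(1) by simp
    then show ?thesis using g(2) by simp
  qed
  have "pg.subpolygroup (P \<one>\<^bsub>G\<^esub>)"
    unfolding pg.subpolygroup_def
  proof (intro conjI ballI subsetI)
    show "x \<in> B" if "x \<in> P \<one>\<^bsub>G\<^esub>" for x using PB[of "\<one>\<^bsub>G\<^esub>"] that by auto
    show "z \<in> P \<one>\<^bsub>G\<^esub>" if "x \<in> P \<one>\<^bsub>G\<^esub>" "y \<in> P \<one>\<^bsub>G\<^esub>" "z \<in> constituents x y" for x y z
      using Pmult[OF _ _ that] by simp
    show "star x \<in> P \<one>\<^bsub>G\<^esub>" if "x \<in> P \<one>\<^bsub>G\<^esub>" for x using Pstar[OF _ that] by simp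
  qed (rule Pone)
  moreover have "(\<Union>x\<in>B. constituents x (star x)) \<subseteq> P \<one>\<^bsub>G\<^esub>"
  proof
    fix z assume "z \<in> (\<Union>x\<in>B. constituents x (star x))"
    then obtain x where x: "x \<in> B" "z \<in> constituents x (star x)" by blast
    obtain g where g: "g \<in> carrier G" "x \<in> P g" using cover x by blast
    show "z \<in> P \<one>\<^bsub>G\<^esub>"
      using Pmult[OF g(1) _ g(2) Pstar[OF g] x(2)] g(1) by simp
  qed
  ultimately have ad: "pg.adjoint \<subseteq> P \<one>\<^bsub>G\<^esub>" unfolding pg.adjoint_def by (intro hull_minimal)
  have class_const: "y \<in> P g" if rel: "(x, y) \<in> pg.adj_rel" and g: "g \<in> carrier G" "x \<in> P g" for x y g
  proof -
    obtain t where "t \<in> pg.adjoint" "y \<in> constituents t x" using rel unfolding pg.adj_rel_def by blast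
    then show ?thesis using Pmult[of "\<one>\<^bsub>G\<^esub>" g t x y] ad g by auto
  qed
  define \<pi> where "\<pi> a = (THE g. g \<in> carrier G \<and> a \<inter> B \<subseteq> P g)" for a
  have \<pi>: "\<pi> (component x) = g" if g: "g \<in> carrier G" "x \<in> P g" for x g
    unfolding \<pi>_def component_Int_basis
  proof (rule the_equality)
    show "g \<in> carrier G \<and> pg.adj_rel `` {x} \<subseteq> P g" using g class_const by blast
    fix h assume h: "h \<in> carrier G \<and> pg.adj_rel `` {x} \<subseteq> P h"
    have "x \<in> P h" using h pg.adj_rel_refl PB g by blast
    then show "h = g" using h g uniq by blast
  qed
  have "\<pi> \<in> epi U G"
    unfolding epi_iff_subset
  proof (intro conjI homI subsetI)
    fix a assume "a \<in> carrier U"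
    then obtain x where x: "x \<in> B" "a = component x" by (auto simp: carrier_U)
    obtain g where g: "g \<in> carrier G" "x \<in> P g" using cover x by blast
    then show "\<pi> a \<in> carrier G" using \<pi> x by simp
  next
    fix a b assume "a \<in> carrier U" "b \<in> carrier U"
    then obtain x y where xy: "x \<in> B" "y \<in> B" "a = component x" "b = component y" by (auto simp: carrier_U)
    obtain g where g: "g \<in> carrier G" "x \<in> P g" using cover xy by blast
    obtain h where h: "h \<in> carrier G" "y \<in> P h" using cover xy by blast
    obtain z where z: "z \<in> constituents x y" using pg.hmult_nonempty xy by blast
    show "\<pi> (a \<otimes>\<^bsub>U\<^esub> b) = \<pi> a \<otimes>\<^bsub>G\<^esub> \<pi> b"
      unfolding xy mult_U[OF z] \<pi>[OF g] \<pi>[OF h]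
      using \<pi>[OF _ Pmult[OF g(1) h(1) g(2) h(2) z]] g h by simp
  next
    fix g assume g: "g \<in> carrier G"
    then have "P g \<noteq> {}" using nz[OF g] M[OF g] Zspan_empty by auto
    then obtain x where x: "x \<in> P g" by blast
    then show "g \<in> \<pi> ` carrier U" using \<pi>[OF g x] PB[OF g] carrier_U by blast
  qed
  moreover have "is_direct_sum R (M g) {a \<in> carrier U. \<pi> a = g} (universal_grading R B)"
    if g: "g \<in> carrier G" for g
  proof -
    let ?A = "{a \<in> carrier U. \<pi> a = g}"
    have "(\<Union>a\<in>?A. a \<inter> B) = P g"
    proof (intro equalityI subsetI)
      fix y assume "y \<in> (\<Union>a\<in>?A. a \<inter> B)"
      then obtain x where x: "x \<in> B" "\<pi> (component x) = g" "y \<in> component x \<inter> B" by (auto simp: carrier_U)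
      obtain h where h: "h \<in> carrier G" "x \<in> P h" using cover x(1) by blast
      have "(x, y) \<in> pg.adj_rel" using x(3) unfolding component_Int_basis by blast
      then show "y \<in> P g" using class_const h \<pi>[OF h] x(2) by blast
    next
      fix x assume x: "x \<in> P g"
      then have xB: "x \<in> B" using PB g by blast
      then have "x \<in> component x \<inter> B" unfolding component_Int_basis using pg.adj_rel_refl by blast
      then show "x \<in> (\<Union>a\<in>?A. a \<inter> B)" using \<pi>[OF g x] xB carrier_U by blast
    qed
    moreover have "?A \<subseteq> component ` B" using carrier_U by blast
    moreover have "universal_grading R B = (\<lambda>a. a)" by (simp add: fun_eq_iff universal_grading_def)
    ultimately show ?thesis using direct_sum_components[of ?A] M[OF g] by simp
  qed
  ultimately show ?thesis by blast
qed

end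

theorem corollary3p7:
  fixes R :: "('a, 'm) ring_scheme" and B :: "'a set"
  assumes "based_ring R B"
  shows "is_faithful_grading R B (universal_grading_group R B) (universal_grading R B)
    \<and> (\<forall>(G :: ('g, 'n) monoid_scheme) M. is_faithful_grading R B G M \<longrightarrow>
         (\<exists>\<pi>\<in>epi (universal_grading_group R B) G. \<forall>g\<in>carrier G.
            is_direct_sum R (M g)
              {a \<in> carrier (universal_grading_group R B). \<pi> a = g} (universal_grading R B)))"
  using based_ring.universal_grading_faithful[OF assms]
    based_ring.faithful_grading_factors[OF assms] by blast

end
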